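(* For every integer $n\ge 0$ and each $t\in\{9,18\}$, $$c(45n+t)\equiv 0\pmod 5.$$
   Context: For a positive integer $k$, $(q^k;q^k)_\infty:=\prod_{m\ge 1}(1-q^{km})$, viewed as a formal power series in $q$ with integer coefficients. The integers $c(n)$ ($n\ge 0$) are defined by the generating function $$\sum_{n=0}^\infty c(n)q^n=\frac{q\,(q^6;q^6)_\infty^3}{(q;q)_\infty(q^2;q^2)_\infty}.$$ *)

theory Defs
  imports "HOL-Analysis.Analysis" "HOL-Number_Theory.Cong"
begin

text \<open>
  The infinite product is taken in the topology that the library puts on formal power series,
  where convergence means that every coefficient is eventually constant.
  The product index of the library starts at \<open>0\<close>, whence the shift \<open>Suc m\<close>.
\<close>

definition euler_prod :: "nat \<Rightarrow> int fps" where
  "euler_prod k = prodinf (\<lambda>m. 1 - fps_X ^ (k * Suc m))"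

text \<open>
  There is no \<open>inverse\<close> on \<^typ>\<open>int fps\<close>, because \<^typ>\<open>int\<close> has no
  \<open>inverse\<close>. For a power series \<open>f\<close> with constant coefficient \<open>1\<close>,
  \<^term>\<open>fps_right_inverse f 1\<close> is its unique multiplicative inverse. The lemma
  \<open>c_gf_eq\<close> below restates the definition in the form without quotients.
\<close>

definition c_gf :: "int fps" where
  "c_gf = fps_X * euler_prod 6 ^ 3 * fps_right_inverse (euler_prod 1 * euler_prod 2) 1"

definition c :: "nat \<Rightarrow> int" where
  "c n = fps_nth c_gf n"

lemma euler_prod_has_prod:
  assumes "k > 0"
  shows "(\<lambda>m. 1 - fps_X ^ (k * Suc m) :: int fps) has_prod euler_prod k"
    and "fps_nth (euler_prod k) 0 = 1"
proof -
  define f :: "nat \<Rightarrow> int fps" where "f = (\<lambda>m. 1 - fps_X ^ (k * Suc m))"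
  define P where "P N = (\<Prod>i\<le>N. f i)" for N
  define p where "p = Abs_fps (\<lambda>n. fps_nth (P n) n)"
  have step: "fps_nth (P (Suc N)) n = fps_nth (P N) n" if "n \<le> N" for n N
  proof -
    have "n < 1 * Suc (Suc N)" using that by simp
    also have "\<dots> \<le> k * Suc (Suc N)" using assms by (intro mult_le_mono1) simp
    finally have "n < k * Suc (Suc N)" .
    moreover have "P (Suc N) = P N - P N * fps_X ^ (k * Suc (Suc N))"
      by (simp add: P_def f_def right_diff_distrib del: mult_Suc_right power_Suc)
    ultimately show ?thesis by (simp add: fps_X_power_mult_right_nth del: mult_Suc_right)
  qed
  have const: "fps_nth (P N) n = fps_nth p n" if "n \<le> N" for n N
    using that by (induction N rule: dec_induct) (simp_all add: p_def step)
  have lim: "P \<longlonglongrightarrow> p"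
    by (rule tendsto_fpsI) (use const in \<open>auto simp: eventually_sequentially\<close>)
  have p0: "fps_nth p 0 = 1" using assms by (simp add: p_def P_def f_def)
  have "f has_prod p"
    using lim p0 unfolding has_prod_def raw_has_prod_def P_def by auto
  moreover have "q = p" if "f has_prod q" for q
  proof -
    have "fps_nth (f i) 0 = 1" for i using assms by (simp add: f_def)
    then have "f i \<noteq> 0" for i by (metis fps_zero_nth zero_neq_one)
    then have "P \<longlonglongrightarrow> q"
      using that unfolding has_prod_def raw_has_prod_def P_def by auto
    then show ?thesis using lim LIMSEQ_unique by blast
  qed
  ultimately have "prodinf f = p" unfolding prodinf_def by blast
  then have "euler_prod k = p" by (simp add: euler_prod_def f_def)
  with \<open>f has_prod p\<close> p0
  show "(\<lambda>m. 1 - fps_X ^ (k * Suc m) :: int fps) has_prod euler_prod k"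
    and "fps_nth (euler_prod k) 0 = 1"
    by (simp_all add: f_def)
qed

lemma c_gf_eq: "Abs_fps c * (euler_prod 1 * euler_prod 2) = fps_X * euler_prod 6 ^ 3"
proof -
  have "fps_nth (euler_prod 1 * euler_prod 2) 0 * 1 = 1"
    by (simp add: euler_prod_has_prod)
  then have "euler_prod 1 * euler_prod 2 * fps_right_inverse (euler_prod 1 * euler_prod 2) 1 = 1"
    by (rule fps_right_inverse)
  moreover have "Abs_fps c = c_gf" by (rule fps_ext) (simp add: c_def)
  ultimately show ?thesis by (simp add: c_gf_def ac_simps)
qed

end

theory Submission
  imports Defs
begin

text \<open>
  Write \<open>E\<^sub>k\<close> for the Euler product \<open>(q\<^sup>k; q\<^sup>k)\<^sub>\<infinity>\<close>. The congruence holds because, modulo \<open>5\<close>,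
  \<open>\<Sum> c(9 n) q\<^sup>n \<equiv> 3 q\<^sup>3 E\<^sub>1 (E\<^sub>6\<^sup>3 / (E\<^sub>1\<^sup>2 E\<^sub>2))\<^sup>5\<close>. The fifth power is modulo \<open>5\<close> a series in \<open>q\<^sup>5\<close>
  (lemma \<open>five_dvd_fifth_power_nth\<close>), and by the pentagonal number theorem the exponents in \<open>E\<^sub>1\<close> are
  congruent to \<open>0\<close>, \<open>1\<close> or \<open>2\<close> modulo \<open>5\<close> (lemma \<open>euler_nth_eq_0\<close>). The right-hand side therefore has only
  exponents congruent to \<open>3\<close>, \<open>4\<close> or \<open>0\<close>, and \<open>c(9 m)\<close> is divisible by \<open>5\<close> for
  \<open>m\<close> congruent to \<open>1\<close> or \<open>2\<close> modulo \<open>5\<close>.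

  The congruence for \<open>\<Sum> c(9 n) q\<^sup>n\<close> comes from two trisections. The theta series
  \<open>\<phi>(- q) = E\<^sub>1\<^sup>2 / E\<^sub>2\<close> and \<open>\<psi>(q) = E\<^sub>2\<^sup>2 / E\<^sub>1\<close> satisfy \<open>E\<^sub>1 E\<^sub>2 = \<phi>(- q) \<psi>(q)\<close> and
  \<open>E\<^sub>1\<^sup>4 E\<^sub>2 = \<phi>(- q)\<^sup>3 \<psi>(q)\<^sup>2\<close>. Splitting their summation index modulo \<open>3\<close> gives
  \<open>\<psi>(q) = \<alpha> + \<beta>\<close> and, up to a factor that is a series in \<open>q\<^sup>3\<close>, \<open>\<phi>(- q) = \<alpha> - 2 \<beta>\<close>, where \<open>\<alpha>\<close> has only
  exponents divisible by \<open>3\<close> and \<open>\<beta>\<close> only exponents congruent to \<open>1\<close> modulo \<open>3\<close>; the Jacobi triple product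
  turns \<open>\<alpha>\<close> and \<open>\<beta>\<close> into quotients of Euler products. Rationalising the denominators to
  \<open>\<alpha>\<^sup>3 - 8 \<beta>\<^sup>3\<close> and \<open>\<alpha>\<^sup>3 + \<beta>\<^sup>3\<close>, which are series in \<open>q\<^sup>3\<close>, reduces a trisection to
  reading off coefficients of a polynomial in \<open>\<alpha>\<close> and \<open>\<beta>\<close>, and a multiplicative norm from series in \<open>q\<close> to series
  in \<open>q\<^sup>3\<close> evaluates the two denominators (lemmas \<open>L_eta\<close> and \<open>R_eta\<close>). The first trisection
  yields \<open>\<Sum> c(3 n) q\<^sup>n = 3 q E\<^sub>3\<^sup>3 E\<^sub>6\<^sup>3 / (E\<^sub>1\<^sup>4 E\<^sub>2)\<close> (lemma \<open>sect_0_gf\<close>). In the second one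
  three coefficients matter, \<open>15\<close>, \<open>30\<close> and \<open>96\<close>; the first two vanish modulo \<open>5\<close>, and what remains is
  the eta quotient above (lemma \<open>sect_0_sect_0_gf\<close>).
\<close>

section \<open>Power series up to a given order\<close>

text \<open>
  Infinite products are handled through their partial products: two power series that agree up to
  every order are equal, and agreement up to a fixed order is a congruence for the ring operations.
\<close>
definition agree :: "nat \<Rightarrow> int fps \<Rightarrow> int fps \<Rightarrow> bool" where
  "agree N f g \<longleftrightarrow> (\<forall>n<N. fps_nth f n = fps_nth g n)"

lemma agree_refl [simp]: "agree N f f"
  by (simp add: agree_def)

lemma agree_sym: "agree N f g \<Longrightarrow> agree N g f"
  by (simp add: agree_def)

lemma agree_trans [trans]: "agree N f g \<Longrightarrow> agree N g h \<Longrightarrow> agree N f h"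
  by (simp add: agree_def)

lemma eq_if_agree: "(\<And>N. agree N f g) \<Longrightarrow> f = g"
  by (auto simp: agree_def fps_eq_iff)

lemma agree_add: "agree N f g \<Longrightarrow> agree N f' g' \<Longrightarrow> agree N (f + f') (g + g')"
  by (simp add: agree_def)

lemma agree_diff: "agree N f g \<Longrightarrow> agree N f' g' \<Longrightarrow> agree N (f - f') (g - g')"
  by (simp add: agree_def)

lemma agree_mult: "agree N f g \<Longrightarrow> agree N f' g' \<Longrightarrow> agree N (f * f') (g * g')"
  by (auto simp: agree_def fps_mult_nth intro!: sum.cong)

lemma agree_power: "agree N f g \<Longrightarrow> agree N (f ^ k) (g ^ k)"
  by (induction k) (auto intro: agree_mult)

lemma agree_sum: "(\<And>i. i \<in> I \<Longrightarrow> agree N (f i) (g i)) \<Longrightarrow> agree N (sum f I) (sum g I)"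
  by (auto simp: agree_def fps_sum_nth intro!: sum.cong)

lemma agree_prod: "(\<And>i. i \<in> I \<Longrightarrow> agree N (f i) (g i)) \<Longrightarrow> agree N (prod f I) (prod g I)"
  by (induction I rule: infinite_finite_induct) (auto intro: agree_mult)

lemma agree_X_power_mult:
  "agree M f g \<Longrightarrow> N \<le> M + k \<Longrightarrow> agree N (f * fps_X ^ k) (g * fps_X ^ k)"
  by (auto simp: agree_def fps_X_power_mult_right_nth)

lemma agree_cancel_left:
  assumes "fps_nth u 0 = 1" "agree N (u * f) (u * g)"
  shows "agree N f g"
proof -
  define v where "v = fps_right_inverse u 1"
  have vu: "v * u = 1"
    using fps_right_inverse[of u 1] assms(1) by (simp add: v_def mult.commute)
  have "agree N (v * (u * f)) (v * (u * g))"
    by (intro agree_mult assms agree_refl)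
  then show ?thesis by (simp add: mult.assoc[symmetric] vu)
qed

section \<open>Infinite products over arithmetic progressions\<close>

text \<open>
  All products that occur have the form \<open>(1 + \<epsilon> q\<^sup>r) (1 + \<epsilon> q\<^bsup>k + r\<^esup>) (1 + \<epsilon> q\<^bsup>2 k + r\<^esup>) \<dots>\<close> with
  \<open>\<epsilon>\<close> equal to \<open>1\<close> or \<open>- 1\<close>. If \<open>k > 0\<close>, then in the partial product with \<open>Suc n\<close> factors the coefficient of \<open>q\<^sup>n\<close>
  has become stationary, since the exponent in the factor of index \<open>m\<close> is at least \<open>m\<close>.
\<close>
definition qfac :: "int \<Rightarrow> nat \<Rightarrow> nat \<Rightarrow> nat \<Rightarrow> int fps" where
  "qfac \<epsilon> k r m = 1 + fps_const \<epsilon> * fps_X ^ (k * m + r)"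

definition qprod :: "int \<Rightarrow> nat \<Rightarrow> nat \<Rightarrow> int fps" where
  "qprod \<epsilon> k r = Abs_fps (\<lambda>n. fps_nth (\<Prod>m<Suc n. qfac \<epsilon> k r m) n)"

lemma qfac_minus: "qfac (- 1) k r m = 1 - fps_X ^ (k * m + r)"
  by (rule fps_ext) (simp add: qfac_def)

lemma qfac_plus: "qfac 1 k r m = 1 + fps_X ^ (k * m + r)"
  by (simp add: qfac_def)

lemma agree_qfac: "N \<le> k * m + r \<Longrightarrow> agree N (qfac \<epsilon> k r m) 1"
  by (auto simp: agree_def qfac_def)

lemma agree_qprod:
  assumes "k > 0" "N \<le> M"
  shows "agree N (qprod \<epsilon> k r) (\<Prod>m<M. qfac \<epsilon> k r m)"
proof -
  have step_agree: "agree K (\<Prod>m<Suc K'. qfac \<epsilon> k r m) (\<Prod>m<K'. qfac \<epsilon> k r m)" if "K \<le> K'" for K K'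
  proof -
    have "K' \<le> k * K'" using assms(1) by simp
    then have "agree K (qfac \<epsilon> k r K') 1" using that by (intro agree_qfac) linarith
    from agree_mult[OF agree_refl[of K "\<Prod>m<K'. qfac \<epsilon> k r m"] this] show ?thesis
      by simp
  qed
  have *: "agree K (\<Prod>m<K'. qfac \<epsilon> k r m) (\<Prod>m<K. qfac \<epsilon> k r m)" if "K \<le> K'" for K K'
    using that
  proof (induction K' rule: dec_induct)
    case (step K')
    from agree_trans[OF step_agree[OF step(1)] step(3)] show ?case .
  qed simp
  show ?thesis unfolding agree_def
  proof (intro allI impI)
    fix n assume "n < N"
    then have "Suc n \<le> M" using assms by simp
    from *[OF this] show "fps_nth (qprod \<epsilon> k r) n = fps_nth (\<Prod>m<M. qfac \<epsilon> k r m) n"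
      by (simp only: agree_def qprod_def fps_nth_Abs_fps lessI)
  qed
qed

lemma qprod_nth_0:
  assumes "k > 0" "r > 0"
  shows "fps_nth (qprod \<epsilon> k r) 0 = 1"
proof -
  have "agree 1 (qprod \<epsilon> k r) (qfac \<epsilon> k r 0)"
    using agree_qprod[OF \<open>k > 0\<close>, of 1 1 \<epsilon> r] by simp
  then show ?thesis using assms by (simp add: agree_def qfac_def)
qed

lemma euler_prod_eq_qprod:
  assumes "k > 0"
  shows "euler_prod k = qprod (- 1) k k"
proof (rule fps_ext)
  fix n
  have fac: "qfac (- 1) k k m = 1 - fps_X ^ (k * Suc m)" for m
    by (simp add: qfac_minus add.commute)
  have "raw_has_prod (\<lambda>m. 1 - fps_X ^ (k * Suc m) :: int fps) 0 (euler_prod k)"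
    using euler_prod_has_prod[OF assms] by (auto simp: has_prod_def)
  then have "(\<lambda>N. \<Prod>m\<le>N. qfac (- 1) k k m) \<longlonglongrightarrow> euler_prod k"
    by (simp add: raw_has_prod_def fac)
  then have "eventually (\<lambda>N. fps_nth (\<Prod>m\<le>N. qfac (- 1) k k m) n = fps_nth (euler_prod k) n) sequentially"
    by (simp add: tendsto_fps_iff)
  moreover have "eventually (\<lambda>N. N \<ge> n) sequentially" by (rule eventually_ge_at_top)
  ultimately have "eventually (\<lambda>N. fps_nth (\<Prod>m\<le>N. qfac (- 1) k k m) n = fps_nth (euler_prod k) n
      \<and> N \<ge> n) sequentially" by eventually_elim simp
  then obtain N where N: "fps_nth (\<Prod>m\<le>N. qfac (- 1) k k m) n = fps_nth (euler_prod k) n" "N \<ge> n"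
    using eventually_happens'[OF sequentially_bot] by blast
  have "agree (Suc n) (qprod (- 1) k k) (\<Prod>m<Suc N. qfac (- 1) k k m)"
    using assms N by (intro agree_qprod) auto
  then show "fps_nth (euler_prod k) n = fps_nth (qprod (- 1) k k) n"
    using N unfolding agree_def lessThan_Suc_atMost by simp
qed

text \<open>
  Grouping the factors by the residue of their index modulo \<open>l\<close>. With this lemma and the next one
  every product over residue classes becomes a quotient of Euler products.
\<close>
lemma qprod_split:
  assumes "k > 0" "l > 0"
  shows "qprod \<epsilon> k r = (\<Prod>j<l. qprod \<epsilon> (l * k) (r + j * k))"
proof (rule eq_if_agree)
  fix N
  have "agree N (qprod \<epsilon> k r) (\<Prod>m<N * l. qfac \<epsilon> k r m)"
    using assms by (intro agree_qprod) auto
  also have "(\<Prod>m<N * l. qfac \<epsilon> k r m) = (\<Prod>m<N. \<Prod>j<l. qfac \<epsilon> k r (j + m * l))"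
  proof -
    have "(\<Prod>i\<in>{m * l..<m * l + l}. qfac \<epsilon> k r i) = (\<Prod>j<l. qfac \<epsilon> k r (j + m * l))" for m
      using prod.shift_bounds_nat_ivl[of "qfac \<epsilon> k r" 0 "m * l" l]
      by (simp add: lessThan_atLeast0 add.commute)
    then show ?thesis by (simp only: prod.nat_group[symmetric])
  qed
  also have "\<dots> = (\<Prod>j<l. \<Prod>m<N. qfac \<epsilon> (l * k) (r + j * k) m)"
    by (subst prod.swap) (simp add: qfac_def algebra_simps)
  also have "agree N \<dots> (\<Prod>j<l. qprod \<epsilon> (l * k) (r + j * k))"
    using assms by (intro agree_prod agree_sym[OF agree_qprod]) auto
  finally show "agree N (qprod \<epsilon> k r) (\<Prod>j<l. qprod \<epsilon> (l * k) (r + j * k))" .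
qed

lemma qprod_minus_mult_plus:
  assumes "k > 0"
  shows "qprod (- 1) k r * qprod 1 k r = qprod (- 1) (2 * k) (2 * r)"
proof (rule eq_if_agree)
  fix N
  have "agree N (qprod (- 1) k r * qprod 1 k r) ((\<Prod>m<N. qfac (- 1) k r m) * (\<Prod>m<N. qfac 1 k r m))"
    using assms by (intro agree_mult agree_qprod) auto
  also have "\<dots> = (\<Prod>m<N. qfac (- 1) (2 * k) (2 * r) m)"
  proof -
    have "qfac (- 1) k r m * qfac 1 k r m = qfac (- 1) (2 * k) (2 * r) m" for m
    proof -
      have "2 * k * m + 2 * r = (k * m + r) + (k * m + r)" by simp
      then show ?thesis unfolding qfac_minus qfac_plus
        by (simp only: power_add) (simp add: algebra_simps)
    qed
    then show ?thesis by (simp add: prod.distrib[symmetric])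
  qed
  also have "agree N \<dots> (qprod (- 1) (2 * k) (2 * r))"
    using assms by (intro agree_sym[OF agree_qprod]) auto
  finally show "agree N (qprod (- 1) k r * qprod 1 k r) (qprod (- 1) (2 * k) (2 * r))" .
qed

lemma qprod_zero_offset:
  assumes "k > 0"
  shows "qprod \<epsilon> k 0 = fps_const (1 + \<epsilon>) * qprod \<epsilon> k k"
proof (rule eq_if_agree)
  fix N
  have "agree N (qprod \<epsilon> k 0) (\<Prod>m<Suc N. qfac \<epsilon> k 0 m)"
    using assms by (intro agree_qprod) auto
  also have "\<dots> = fps_const (1 + \<epsilon>) * (\<Prod>m<N. qfac \<epsilon> k k m)"
  proof -
    have "qfac \<epsilon> k 0 0 = fps_const (1 + \<epsilon>)"
      by (rule fps_ext) (simp add: qfac_def)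
    moreover have "qfac \<epsilon> k 0 (Suc m) = qfac \<epsilon> k k m" for m
      by (simp add: qfac_def add.commute)
    ultimately show ?thesis
      by (simp only: prod.lessThan_Suc_shift)
  qed
  also have "agree N \<dots> (fps_const (1 + \<epsilon>) * qprod \<epsilon> k k)"
    using assms by (intro agree_mult agree_refl agree_sym[OF agree_qprod]) auto
  finally show "agree N (qprod \<epsilon> k 0) (fps_const (1 + \<epsilon>) * qprod \<epsilon> k k)" .
qed

section \<open>The Jacobi triple product\<close>

text \<open>
  The triple product is the limit of a finite identity in which the coefficients of the theta
  series are weighted by Gaussian binomial coefficients. The two variables of the classical identity
  are specialised to \<open>\<epsilon> q\<^sup>r\<close> and \<open>\<epsilon> q\<^sup>s\<close> from the start, which keeps everything inside the power
  series in \<open>q\<close>; the base is their product \<open>q\<^bsup>r + s\<^esup>\<close>.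
\<close>
fun gauss_binom :: "int fps \<Rightarrow> nat \<Rightarrow> nat \<Rightarrow> int fps" where
  "gauss_binom q m 0 = 1"
| "gauss_binom q 0 (Suc i) = 0"
| "gauss_binom q (Suc m) (Suc i) = gauss_binom q m i + q ^ Suc i * gauss_binom q m (Suc i)"

lemma gauss_binom_eq_0: "m < i \<Longrightarrow> gauss_binom q m i = 0"
  by (induction q m i rule: gauss_binom.induct) auto

definition qpoch :: "int fps \<Rightarrow> nat \<Rightarrow> int fps" where
  "qpoch q n = (\<Prod>j<n. 1 - q ^ Suc j)"

lemma qpoch_Suc: "qpoch q (Suc n) = qpoch q n * (1 - q ^ Suc n)"
  by (simp add: qpoch_def)

lemma gauss_binom_qpoch:
  "i \<le> m \<Longrightarrow> gauss_binom q m i * qpoch q i * qpoch q (m - i) = qpoch q m"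
proof (induction m arbitrary: i)
  case 0
  then show ?case by (simp add: qpoch_def)
next
  case (Suc m)
  show ?case
  proof (cases i)
    case 0
    then show ?thesis by (simp add: qpoch_def)
  next
    case i: (Suc j)
    have jm: "j \<le> m" using Suc.prems i by simp
    have 1: "gauss_binom q m j * qpoch q j * qpoch q (m - j) = qpoch q m"
      using Suc.IH[OF jm] .
    have 2: "gauss_binom q m (Suc j) * qpoch q (Suc j) * qpoch q (m - j) = qpoch q m * (1 - q ^ (m - j))"
    proof (cases "j = m")
      case True
      then show ?thesis by (simp add: gauss_binom_eq_0)
    next
      case False
      then have "Suc j \<le> m" "m - j = Suc (m - Suc j)" using jm by auto
      then show ?thesis using Suc.IH[of "Suc j"] by (simp add: qpoch_Suc mult.assoc[symmetric])
    qed
    have "gauss_binom q (Suc m) i * qpoch q i * qpoch q (Suc m - i)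
       = gauss_binom q m j * qpoch q j * qpoch q (m - j) * (1 - q ^ Suc j)
         + q ^ Suc j * (gauss_binom q m (Suc j) * qpoch q (Suc j) * qpoch q (m - j))"
      by (simp add: i qpoch_Suc algebra_simps)
    also have "\<dots> = qpoch q m * (1 - q ^ (Suc j + (m - j)))"
      unfolding 1 2 power_add by (simp add: algebra_simps)
    also have "Suc j + (m - j) = Suc m" using jm by simp
    finally show ?thesis by (simp add: qpoch_Suc)
  qed
qed

lemma qpoch_nonzero:
  assumes "fps_nth q 0 = 0"
  shows "qpoch q n \<noteq> 0"
proof -
  have "fps_nth (qpoch q n) 0 = 1"
    using assms by (induction n) (simp_all add: qpoch_def fps_power_zeroth)
  then show ?thesis by auto
qed

text \<open>
  The second Pascal rule differs from the defining one by the identity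
  \<open>(1 - q\<^bsup>i + 1\<^esup>) [m, i + 1] = (1 - q\<^bsup>m - i\<^esup>) [m, i]\<close>, which follows from the factorial formula.
\<close>
lemma gauss_binom_Suc_Suc':
  assumes "fps_nth q 0 = 0" "i \<le> m"
  shows "gauss_binom q (Suc m) (Suc i) = q ^ (m - i) * gauss_binom q m i + gauss_binom q m (Suc i)"
proof -
  have "(1 - q ^ Suc i) * gauss_binom q m (Suc i) = (1 - q ^ (m - i)) * gauss_binom q m i"
  proof (cases "i = m")
    case True
    then show ?thesis by (simp add: gauss_binom_eq_0)
  next
    case False
    then have i: "Suc i \<le> m" "m - i = Suc (m - Suc i)" using assms by auto
    have "(1 - q ^ Suc i) * gauss_binom q m (Suc i) * (qpoch q i * qpoch q (m - Suc i)) = qpoch q m"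
      using gauss_binom_qpoch[OF i(1), of q] by (simp add: qpoch_Suc algebra_simps)
    moreover have "(1 - q ^ (m - i)) * gauss_binom q m i * (qpoch q i * qpoch q (m - Suc i)) = qpoch q m"
      using gauss_binom_qpoch[OF assms(2), of q] unfolding i(2) qpoch_Suc by (simp add: mult_ac)
    ultimately show ?thesis
      using qpoch_nonzero[OF assms(1)] by (metis mult_right_cancel mult_eq_0_iff)
  qed
  then show ?thesis by (simp add: algebra_simps)
qed

text \<open>
  The Pascal rules in summed form. In the finite triple product one of them absorbs each new
  factor \<open>1 + \<epsilon> q\<^bsup>(r + s) n + r\<^esup>\<close>, the other each new factor \<open>1 + \<epsilon> q\<^bsup>(r + s) n + s\<^esup>\<close>.
\<close>
lemma sum_gauss_binom_Suc:
  "(\<Sum>i\<le>Suc m. gauss_binom q (Suc m) i * u i)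
    = (\<Sum>i\<le>m. gauss_binom q m i * (u (Suc i) + q ^ i * u i))"
proof -
  have "(\<Sum>i\<le>Suc m. gauss_binom q (Suc m) i * u i)
      = u 0 + (\<Sum>i\<le>m. (gauss_binom q m i + q ^ Suc i * gauss_binom q m (Suc i)) * u (Suc i))"
    by (subst sum.atMost_Suc_shift) simp
  also have "\<dots> = (\<Sum>i\<le>m. gauss_binom q m i * u (Suc i))
      + (\<Sum>i\<le>Suc m. q ^ i * gauss_binom q m i * u i)"
    by (subst sum.atMost_Suc_shift) (simp add: algebra_simps sum.distrib)
  also have "(\<Sum>i\<le>Suc m. q ^ i * gauss_binom q m i * u i) = (\<Sum>i\<le>m. q ^ i * gauss_binom q m i * u i)"
    by (simp add: gauss_binom_eq_0)
  finally show ?thesis by (simp add: algebra_simps sum.distrib)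
qed

lemma sum_gauss_binom_Suc':
  assumes "fps_nth q 0 = 0"
  shows "(\<Sum>i\<le>Suc m. gauss_binom q (Suc m) i * u i)
    = (\<Sum>i\<le>m. gauss_binom q m i * (q ^ (m - i) * u (Suc i) + u i))"
proof -
  have "(\<Sum>i\<le>Suc m. gauss_binom q (Suc m) i * u i)
      = u 0 + (\<Sum>i\<le>m. (q ^ (m - i) * gauss_binom q m i + gauss_binom q m (Suc i)) * u (Suc i))"
    using gauss_binom_Suc_Suc'[OF assms]
    by (subst sum.atMost_Suc_shift) (simp del: gauss_binom.simps(3))
  also have "\<dots> = (\<Sum>i\<le>m. q ^ (m - i) * gauss_binom q m i * u (Suc i))
      + (\<Sum>i\<le>Suc m. gauss_binom q m i * u i)"
    by (subst sum.atMost_Suc_shift) (simp add: algebra_simps sum.distrib)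
  also have "(\<Sum>i\<le>Suc m. gauss_binom q m i * u i) = (\<Sum>i\<le>m. gauss_binom q m i * u i)"
    by (simp add: gauss_binom_eq_0)
  finally show ?thesis by (simp add: algebra_simps sum.distrib)
qed

text \<open>
  Ramanujan's theta series \<open>f(\<epsilon> q\<^sup>r, \<epsilon> q\<^sup>s)\<close>, the sum over all integers \<open>k\<close> of
  \<open>\<epsilon>\<^sup>k q\<^bsup>r k (k + 1) / 2 + s k (k - 1) / 2\<^esup>\<close>. One of \<open>r\<close> and \<open>s\<close> may be zero.
\<close>
definition theta_exp :: "nat \<Rightarrow> nat \<Rightarrow> int \<Rightarrow> nat" where
  "theta_exp r s k = nat ((int r * (k * (k + 1)) + int s * (k * (k - 1))) div 2)"

definition theta_sign :: "int \<Rightarrow> int \<Rightarrow> int" where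
  "theta_sign \<epsilon> k = (if even k then 1 else \<epsilon>)"

definition theta :: "int \<Rightarrow> nat \<Rightarrow> nat \<Rightarrow> int fps" where
  "theta \<epsilon> r s = Abs_fps (\<lambda>n. \<Sum>k | theta_exp r s k = n. theta_sign \<epsilon> k)"

lemma pronic_nonneg: "k * (k + 1) \<ge> 0" "k * (k - 1) \<ge> 0" for k :: int
  by (auto simp: zero_le_mult_iff)

lemma two_theta_exp:
  "2 * int (theta_exp r s k) = int r * (k * (k + 1)) + int s * (k * (k - 1))"
proof -
  have "even (int r * (k * (k + 1)) + int s * (k * (k - 1)))" by simp
  moreover have "int r * (k * (k + 1)) + int s * (k * (k - 1)) \<ge> 0"
    using pronic_nonneg[of k] by simp
  ultimately show ?thesis by (auto simp: theta_exp_def elim!: evenE)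
qed

lemma theta_exp_Suc:
  "int (theta_exp r s (k + 1)) = int (theta_exp r s k) + int (r + s) * k + int r"
  using two_theta_exp[of r s "k + 1"] two_theta_exp[of r s k] by (simp add: algebra_simps)

text \<open>
  This bound makes the coefficients of the theta series finite sums, and it says that a partial sum
  over \<open>\<bar>k\<bar> \<le> M\<close> is correct up to order \<open>M\<close>. The summand \<open>1\<close> is due to the case \<open>r = 0\<close> or \<open>s = 0\<close>,
  where two values of \<open>k\<close> have exponent \<open>0\<close>.
\<close>
lemma abs_le_theta_exp:
  assumes "r + s > 0"
  shows "\<bar>k\<bar> \<le> int (theta_exp r s k) + 1"
proof -
  define m where "m = min (k * (k + 1)) (k * (k - 1))"
  have "m \<ge> 2 * (\<bar>k\<bar> - 1)"
  proof (cases "k \<ge> 0")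
    case True
    have "(k - 1) * (k - 2) \<ge> 0" using pronic_nonneg(2)[of "k - 1"] by (simp add: algebra_simps)
    moreover have "k * (k + 1) \<ge> k * (k - 1)" using True by (intro mult_left_mono) auto
    ultimately show ?thesis using True by (simp add: m_def algebra_simps)
  next
    case False
    have "(k + 1) * (k + 2) \<ge> 0" using pronic_nonneg(1)[of "k + 1"] by (simp add: algebra_simps)
    moreover have "k * (k - 1) \<ge> k * (k + 1)" using False by (intro mult_left_mono_neg) auto
    ultimately show ?thesis using False by (simp add: m_def algebra_simps)
  qed
  moreover have "m \<ge> 0" using pronic_nonneg[of k] by (simp add: m_def)
  moreover have "2 * int (theta_exp r s k) \<ge> int r * m + int s * m"
    unfolding two_theta_exp m_def by (intro add_mono mult_left_mono) auto
  moreover have "int r * m + int s * m \<ge> m"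
  proof -
    have "int (r + s) * m \<ge> 1 * m" using assms \<open>m \<ge> 0\<close> by (intro mult_right_mono) auto
    then show ?thesis by (simp add: distrib_right)
  qed
  ultimately have "2 * (\<bar>k\<bar> - 1) \<le> 2 * int (theta_exp r s k)"
    by (meson order_trans)
  then show ?thesis by simp
qed

lemma finite_theta_exp:
  assumes "r + s > 0"
  shows "finite {k. theta_exp r s k = n}"
proof (rule finite_subset)
  show "{k. theta_exp r s k = n} \<subseteq> {- int n - 1..int n + 1}"
  proof
    fix k assume "k \<in> {k. theta_exp r s k = n}"
    with abs_le_theta_exp[OF assms, of k] show "k \<in> {- int n - 1..int n + 1}" by (auto simp: abs_le_iff)
  qed
qed simp

definition theta_term :: "int \<Rightarrow> nat \<Rightarrow> nat \<Rightarrow> int \<Rightarrow> int fps" where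
  "theta_term \<epsilon> r s k = fps_const (theta_sign \<epsilon> k) * fps_X ^ theta_exp r s k"

text \<open>
  The partial sums are indexed by \<open>i = k + M\<close>, which is also the lower index of the Gaussian binomial
  coefficient that goes with \<open>k\<close>.
\<close>
lemma agree_theta:
  assumes "r + s > 0" "N \<le> M"
  shows "agree N (theta \<epsilon> r s) (\<Sum>i\<le>2 * M. theta_term \<epsilon> r s (int i - int M))"
  unfolding agree_def
proof (intro allI impI)
  fix n assume n: "n < N"
  have "fps_nth (\<Sum>i\<le>2 * M. theta_term \<epsilon> r s (int i - int M)) n
      = (\<Sum>i\<le>2 * M. if theta_exp r s (int i - int M) = n then theta_sign \<epsilon> (int i - int M) else 0)"
    by (auto simp: fps_sum_nth theta_term_def intro!: sum.cong)
  also have "\<dots> = (\<Sum>i | i \<le> 2 * M \<and> theta_exp r s (int i - int M) = n. theta_sign \<epsilon> (int i - int M))"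
    by (simp add: sum.inter_filter[symmetric])
  also have "\<dots> = (\<Sum>k | theta_exp r s k = n. theta_sign \<epsilon> k)"
  proof (rule sum.reindex_bij_witness[of _ "\<lambda>k. nat (k + int M)" "\<lambda>i. int i - int M"])
    fix k assume "k \<in> {k. theta_exp r s k = n}"
    then have "\<bar>k\<bar> \<le> int M" using abs_le_theta_exp[OF assms(1), of k] n assms(2) by auto
    with \<open>k \<in> _\<close> show "int (nat (k + int M)) - int M = k"
      "nat (k + int M) \<in> {i. i \<le> 2 * M \<and> theta_exp r s (int i - int M) = n}"
      by auto
  qed auto
  finally show "fps_nth (theta \<epsilon> r s) n = fps_nth (\<Sum>i\<le>2 * M. theta_term \<epsilon> r s (int i - int M)) n"
    by (simp add: theta_def)
qed


text \<open>
  Cauchy's finite form of the triple product. The induction step multiplies by the two new factors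
  in turn: multiplication of the \<open>k\<close>-th theta term by \<open>\<epsilon> q\<^bsup>(r + s) n + r\<^esup>\<close> gives a power of
  \<open>q\<^bsup>r + s\<^esup>\<close> times the term of index \<open>k + 1\<close>, and \<open>\<epsilon> q\<^bsup>(r + s) n + s\<^esup>\<close> leads back from \<open>k + 1\<close> to \<open>k\<close>
  in the same way, so that the Pascal rules apply.
\<close>
lemma finite_triple_product:
  assumes "r + s > 0" "\<epsilon> * \<epsilon> = 1"
  shows "(\<Prod>j<n. qfac \<epsilon> (r + s) r j) * (\<Prod>j<n. qfac \<epsilon> (r + s) s j)
    = (\<Sum>i\<le>2 * n. gauss_binom (fps_X ^ (r + s)) (2 * n) i * theta_term \<epsilon> r s (int i - int n))"
proof (induction n)
  case 0
  show ?case by (simp add: theta_term_def theta_sign_def theta_exp_def)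
next
  case (Suc n)
  define q :: "int fps" where "q = fps_X ^ (r + s)"
  define t where "t = theta_term \<epsilon> r s"
  have q0: "fps_nth q 0 = 0" using assms(1) by (simp add: q_def)
  have sign: "theta_sign \<epsilon> (k + 1) = \<epsilon> * theta_sign \<epsilon> k" for k
    using assms(2) by (simp add: theta_sign_def)
  have up: "t k * qfac \<epsilon> (r + s) r n = q ^ nat (int n - k) * t (k + 1) + t k" if "k \<le> int n" for k
  proof -
    define d where "d = nat (int n - k)"
    have k: "k = int n - int d" using that by (simp add: d_def)
    have "int ((r + s) * d + theta_exp r s (k + 1)) = int (theta_exp r s k + ((r + s) * n + r))"
      using theta_exp_Suc[of r s k] by (simp add: k algebra_simps)
    then have e: "(r + s) * d + theta_exp r s (k + 1) = theta_exp r s k + ((r + s) * n + r)"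
      by (simp only: of_nat_eq_iff)
    have "t k * (fps_const \<epsilon> * fps_X ^ ((r + s) * n + r))
        = fps_const (\<epsilon> * theta_sign \<epsilon> k) * fps_X ^ (theta_exp r s k + ((r + s) * n + r))"
      by (simp add: t_def theta_term_def power_add mult_ac flip: fps_const_mult)
    also have "\<dots> = q ^ d * t (k + 1)"
      unfolding e[symmetric] power_add[of _ "(r + s) * d"]
      by (simp add: t_def theta_term_def sign q_def mult_ac flip: power_mult)
    finally show ?thesis by (simp add: qfac_def algebra_simps d_def)
  qed
  have down: "t (k + 1) * qfac \<epsilon> (r + s) s n = t (k + 1) + q ^ nat (int n + k + 1) * t k"
    if "k \<ge> - int n - 1" for k
  proof -
    define d where "d = nat (int n + k + 1)"
    have k: "k = int d - int n - 1" using that by (simp add: d_def)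
    have "int ((r + s) * d + theta_exp r s k) = int (theta_exp r s (k + 1) + ((r + s) * n + s))"
      using theta_exp_Suc[of r s k] by (simp add: k algebra_simps)
    then have e: "(r + s) * d + theta_exp r s k = theta_exp r s (k + 1) + ((r + s) * n + s)"
      by (simp only: of_nat_eq_iff)
    have "t (k + 1) * (fps_const \<epsilon> * fps_X ^ ((r + s) * n + s))
        = fps_const (\<epsilon> * (\<epsilon> * theta_sign \<epsilon> k)) * fps_X ^ (theta_exp r s (k + 1) + ((r + s) * n + s))"
      by (simp add: t_def theta_term_def power_add mult_ac sign flip: fps_const_mult)
    also have "\<epsilon> * (\<epsilon> * theta_sign \<epsilon> k) = theta_sign \<epsilon> k"
      using assms(2) by (simp flip: mult.assoc)
    also have "fps_const (theta_sign \<epsilon> k) * fps_X ^ (theta_exp r s (k + 1) + ((r + s) * n + s)) = q ^ d * t k"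
      unfolding e[symmetric] power_add[of _ "(r + s) * d"]
      by (simp add: t_def theta_term_def q_def mult_ac flip: power_mult)
    finally show ?thesis by (simp add: qfac_def algebra_simps d_def)
  qed
  have "(\<Prod>j<Suc n. qfac \<epsilon> (r + s) r j) * (\<Prod>j<Suc n. qfac \<epsilon> (r + s) s j)
      = (\<Sum>i\<le>2 * n. gauss_binom q (2 * n) i * (t (int i - int n) * qfac \<epsilon> (r + s) r n)) * qfac \<epsilon> (r + s) s n"
    using Suc.IH by (simp add: mult_ac sum_distrib_left flip: q_def t_def)
  also have "(\<Sum>i\<le>2 * n. gauss_binom q (2 * n) i * (t (int i - int n) * qfac \<epsilon> (r + s) r n))
      = (\<Sum>i\<le>2 * n. gauss_binom q (2 * n) i * (q ^ (2 * n - i) * t (int (Suc i) - int n) + t (int i - int n)))"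
  proof (rule sum.cong[OF refl])
    fix i assume "i \<in> {..2 * n}"
    moreover from this have "nat (int n - (int i - int n)) = 2 * n - i" by auto
    ultimately show "gauss_binom q (2 * n) i * (t (int i - int n) * qfac \<epsilon> (r + s) r n)
      = gauss_binom q (2 * n) i * (q ^ (2 * n - i) * t (int (Suc i) - int n) + t (int i - int n))"
      using up[of "int i - int n"] by (simp add: algebra_simps)
  qed
  also have "\<dots> = (\<Sum>i\<le>Suc (2 * n). gauss_binom q (Suc (2 * n)) i * t (int i - int n))"
    by (rule sum_gauss_binom_Suc'[OF q0, symmetric])
  also have "\<dots> * qfac \<epsilon> (r + s) s n
      = (\<Sum>i\<le>Suc (2 * n). gauss_binom q (Suc (2 * n)) i * (t (int (Suc i) - int (Suc n)) + q ^ i * t (int i - int (Suc n))))"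
    unfolding sum_distrib_right
  proof (rule sum.cong[OF refl])
    fix i
    show "gauss_binom q (Suc (2 * n)) i * t (int i - int n) * qfac \<epsilon> (r + s) s n
      = gauss_binom q (Suc (2 * n)) i * (t (int (Suc i) - int (Suc n)) + q ^ i * t (int i - int (Suc n)))"
      using down[of "int i - int (Suc n)"] by (simp add: mult.assoc)
  qed
  also have "\<dots> = (\<Sum>i\<le>Suc (Suc (2 * n)). gauss_binom q (Suc (Suc (2 * n))) i * t (int i - int (Suc n)))"
    by (rule sum_gauss_binom_Suc[symmetric])
  finally show ?case by (simp add: q_def t_def)
qed

text \<open>
  In the limit \<open>[2 n, n + k]\<close> times the Euler product of the base tends to \<open>1\<close>. The product is
  correct up to order \<open>n - \<bar>k\<bar>\<close> only, but it multiplies a theta term of order at least \<open>\<bar>k\<bar> - 1\<close>,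
  so all errors have order at least \<open>n - 1\<close>.
\<close>
theorem triple_product:
  assumes "r + s > 0" "\<epsilon> * \<epsilon> = 1"
  shows "qprod (- 1) (r + s) (r + s) * (qprod \<epsilon> (r + s) r * qprod \<epsilon> (r + s) s) = theta \<epsilon> r s"
proof (rule eq_if_agree)
  fix N
  define n where "n = Suc N"
  define q :: "int fps" where "q = fps_X ^ (r + s)"
  define E where "E = qprod (- 1) (r + s) (r + s)"
  have E0: "fps_nth E 0 = 1" using assms by (simp add: E_def qprod_nth_0)
  have poch: "agree M E (qpoch q j)" if "M \<le> j" for M j
  proof -
    have "qpoch q j = (\<Prod>m<j. qfac (- 1) (r + s) (r + s) m)"
      unfolding qpoch_def
      by (intro prod.cong refl) (simp add: qfac_minus q_def add.commute flip: power_mult del: power_Suc)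
    then show ?thesis using agree_qprod[of "r + s" M j] assms that by (simp add: E_def)
  qed
  \<comment> \<open>The factorial formula reads \<open>[2 n, i] (q)\<^sub>i (q)\<^bsub>2 n - i\<^esub> = (q)\<^bsub>2 n\<^esub>\<close>, and all three factorials
      agree with the infinite product.\<close>
  have binom: "agree M (gauss_binom q (2 * n) i * E) 1" if "i \<le> 2 * n" "M \<le> i" "M \<le> 2 * n - i" for i M
  proof (rule agree_cancel_left[OF E0])
    have "agree M (gauss_binom q (2 * n) i * E * E)
        (gauss_binom q (2 * n) i * qpoch q i * qpoch q (2 * n - i))"
      using that by (intro agree_mult poch agree_refl)
    also have "\<dots> = qpoch q (2 * n)" using gauss_binom_qpoch[OF that(1)] .
    also have "agree M \<dots> E" using that by (intro agree_sym[OF poch]) auto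
    finally show "agree M (E * (gauss_binom q (2 * n) i * E)) (E * 1)" by (simp add: mult_ac)
  qed
  have "agree N (E * (qprod \<epsilon> (r + s) r * qprod \<epsilon> (r + s) s))
      (E * ((\<Prod>j<n. qfac \<epsilon> (r + s) r j) * (\<Prod>j<n. qfac \<epsilon> (r + s) s j)))"
    using assms by (intro agree_mult agree_refl agree_qprod) (auto simp: n_def)
  also have "\<dots> = (\<Sum>i\<le>2 * n. gauss_binom q (2 * n) i * E * theta_term \<epsilon> r s (int i - int n))"
    unfolding finite_triple_product[OF assms] by (simp add: q_def sum_distrib_left mult_ac)
  also have "agree N \<dots> (\<Sum>i\<le>2 * n. theta_term \<epsilon> r s (int i - int n))"
  proof (rule agree_sum)
    fix i assume i: "i \<in> {..2 * n}"
    define k where "k = int i - int n"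
    have "agree N (gauss_binom q (2 * n) i * E * fps_X ^ theta_exp r s k) (1 * fps_X ^ theta_exp r s k)"
      using i abs_le_theta_exp[OF assms(1), of k]
      by (intro agree_X_power_mult[of "min i (2 * n - i)"] binom) (auto simp: k_def n_def)
    then have "agree N (fps_const (theta_sign \<epsilon> k) * (gauss_binom q (2 * n) i * E * fps_X ^ theta_exp r s k))
        (fps_const (theta_sign \<epsilon> k) * (1 * fps_X ^ theta_exp r s k))"
      by (rule agree_mult[OF agree_refl])
    then show "agree N (gauss_binom q (2 * n) i * E * theta_term \<epsilon> r s (int i - int n))
        (theta_term \<epsilon> r s (int i - int n))"
      by (simp add: theta_term_def k_def mult_ac)
  qed
  also have "agree N \<dots> (theta \<epsilon> r s)"
    using assms by (intro agree_sym[OF agree_theta]) (auto simp: n_def)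
  finally show "agree N (qprod (- 1) (r + s) (r + s) * (qprod \<epsilon> (r + s) r * qprod \<epsilon> (r + s) s)) (theta \<epsilon> r s)"
    by (simp add: E_def)
qed

section \<open>Theta series as eta quotients\<close>

abbreviation E :: "nat \<Rightarrow> int fps" where
  "E k \<equiv> qprod (- 1) k k"

lemma prod_lessThan_2: "(\<Prod>j<2. f j) = f 0 * f (1::nat)" for f :: "nat \<Rightarrow> int fps"
  by (simp add: numeral_2_eq_2)

lemma prod_lessThan_3: "(\<Prod>j<3. f j) = f 0 * f 1 * f (2::nat)" for f :: "nat \<Rightarrow> int fps"
  by (simp add: numeral_3_eq_3 numeral_2_eq_2)

lemma prod_lessThan_6: "(\<Prod>j<6. f j) = f 0 * f 1 * f 2 * f 3 * f 4 * f (5::nat)" for f :: "nat \<Rightarrow> int fps"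
proof -
  have "{..<6::nat} = {0, 1, 2, 3, 4, 5}" by auto
  then show ?thesis by (simp add: mult.assoc)
qed

text \<open>
  Gauss's series \<open>\<psi>(q\<^sup>k)\<close>, the sum of \<open>q\<^bsup>k n (n + 1) / 2\<^esup>\<close> over \<open>n \<ge> 0\<close>. As a theta series it appears
  doubled, because in the sum over all integers every exponent occurs twice.
\<close>
definition psi :: "nat \<Rightarrow> int fps" where
  "psi k = E k * (qprod 1 k k)^2"

lemma theta_0:
  assumes "k > 0"
  shows "theta 1 0 k = 2 * psi k" "theta 1 k 0 = 2 * psi k"
proof -
  have "fps_const (1 + 1) = (2 :: int fps)" by (simp add: numeral_fps_const)
  then have "qprod 1 k 0 = 2 * qprod 1 k k" using qprod_zero_offset[OF assms, of 1] by simp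
  then show "theta 1 0 k = 2 * psi k" "theta 1 k 0 = 2 * psi k"
    using triple_product[of 0 k 1] triple_product[of k 0 1] assms
    by (simp_all add: psi_def power2_eq_square mult_ac)
qed

lemma psi_eta: "k > 0 \<Longrightarrow> psi k * E k = E (2 * k) ^ 2"
  using qprod_minus_mult_plus[of k k] by (simp add: psi_def power2_eq_square mult_ac)

text \<open>
  This theta series is \<open>\<phi>(- q\<^sup>k)\<close>, the alternating sum of \<open>q\<^bsup>k n n\<^esup>\<close> over all integers \<open>n\<close>.
\<close>
lemma phi_eta:
  assumes "k > 0"
  shows "theta (- 1) k k * E (2 * k) = E k ^ 2"
proof -
  have "E k = qprod (- 1) (2 * k) k * E (2 * k)"
    using qprod_split[of k 2 "- 1" k] assms by (simp add: prod_lessThan_2 mult_2)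
  moreover have "theta (- 1) k k = E (2 * k) * (qprod (- 1) (2 * k) k * qprod (- 1) (2 * k) k)"
    using triple_product[of k k "- 1"] assms by (simp add: mult_2)
  ultimately show ?thesis by (simp add: power2_eq_square mult_ac)
qed

text \<open>Euler's pentagonal number theorem: the exponents of this theta series are \<open>(3 n n - n) / 2\<close>.\<close>
lemma euler_triple: "theta (- 1) 1 2 = E 1"
  using triple_product[of 1 2 "- 1"] qprod_split[of 1 3 "- 1" 1]
  by (simp add: prod_lessThan_3 mult_ac del: One_nat_def)

lemma theta_1_2_eta: "theta 1 1 2 * E 1 * E 6 = E 2 * E 3 ^ 2"
proof -
  have "theta 1 1 2 = E 3 * (qprod 1 3 1 * qprod 1 3 2)"
    using triple_product[of 1 2 1] by (simp del: One_nat_def)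
  moreover have "qprod 1 1 1 = qprod 1 3 1 * qprod 1 3 2 * qprod 1 3 3"
    using qprod_split[of 1 3 1 1] by (simp add: prod_lessThan_3 del: One_nat_def)
  moreover have "E 1 * qprod 1 1 1 = E 2" "E 3 * qprod 1 3 3 = E 6"
    using qprod_minus_mult_plus[of 1 1] qprod_minus_mult_plus[of 3 3] by simp_all
  ultimately show ?thesis by algebra
qed

text \<open>
  The product runs over the exponents congruent to \<open>1\<close> or \<open>5\<close> modulo \<open>6\<close>, that is, over those coprime to \<open>6\<close>,
  and these are left over when the multiples of \<open>2\<close> and of \<open>3\<close> are removed.
\<close>
lemma theta_5_1_eta: "theta (- 1) 5 1 * E 2 * E 3 = E 1 * E 6 ^ 2"
proof -
  have "theta (- 1) 5 1 = E 6 * (qprod (- 1) 6 5 * qprod (- 1) 6 1)"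
    using triple_product[of 5 1 "- 1"] by (simp del: One_nat_def)
  moreover have "E 1 = qprod (- 1) 6 1 * qprod (- 1) 6 2 * qprod (- 1) 6 3 * qprod (- 1) 6 4
      * qprod (- 1) 6 5 * E 6"
    using qprod_split[of 1 6 "- 1" 1] by (simp add: prod_lessThan_6 del: One_nat_def)
  moreover have "E 2 = qprod (- 1) 6 2 * qprod (- 1) 6 4 * E 6"
    using qprod_split[of 2 3 "- 1" 2] by (simp add: prod_lessThan_3 del: One_nat_def flip: numeral_2_eq_2)
  moreover have "E 3 = qprod (- 1) 6 3 * E 6"
    using qprod_split[of 3 2 "- 1" 3] by (simp add: prod_lessThan_2)
  ultimately show ?thesis by (simp add: power2_eq_square mult_ac del: One_nat_def)
qed

section \<open>Sections modulo 3 and the norm\<close>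

text \<open>
  Every power series \<open>f(q)\<close> is \<open>f\<^sub>0(q\<^sup>3) + q f\<^sub>1(q\<^sup>3) + q\<^sup>2 f\<^sub>2(q\<^sup>3)\<close> with unique \<open>f\<^sub>0, f\<^sub>1, f\<^sub>2\<close>. The sections
  are these three series; dilation is the substitution of \<open>q\<^sup>3\<close> for \<open>q\<close>.
\<close>
definition sect :: "nat \<Rightarrow> int fps \<Rightarrow> int fps" where
  "sect i f = Abs_fps (\<lambda>n. fps_nth f (3 * n + i))"

definition dilate :: "int fps \<Rightarrow> int fps" where
  "dilate f = fps_compose f (fps_X ^ 3)"

lemma dilate_nth: "fps_nth (dilate f) n = (if 3 dvd n then fps_nth f (n div 3) else 0)"
proof -
  have "fps_nth (dilate f) n = (\<Sum>i=0..n. if n = 3 * i then fps_nth f i else 0)"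
    by (auto simp: dilate_def fps_compose_nth simp flip: power_mult intro!: sum.cong)
  also have "\<dots> = (\<Sum>i\<in>(if 3 dvd n then {n div 3} else {}). fps_nth f i)"
    by (intro sum.mono_neutral_cong_right) (auto split: if_splits)
  finally show ?thesis by simp
qed

lemma dilate_add: "dilate (f + g) = dilate f + dilate g"
  by (simp add: dilate_def fps_compose_add_distrib)

lemma dilate_diff: "dilate (f - g) = dilate f - dilate g"
  by (simp add: dilate_def fps_compose_sub_distrib)

lemma dilate_uminus: "dilate (- g) = - dilate g"
  by (simp add: dilate_def fps_compose_uminus)

lemma dilate_mult: "dilate (f * g) = dilate f * dilate g"
  by (simp add: dilate_def fps_compose_mult_distrib)

lemma dilate_power: "dilate (f ^ n) = dilate f ^ n"
  by (simp add: dilate_def fps_compose_power)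

lemma dilate_0: "dilate 0 = 0"
  by (simp add: dilate_def)

lemma dilate_1: "dilate 1 = 1"
  by (simp add: dilate_def)

lemma dilate_numeral: "dilate (numeral n) = numeral n"
  by (rule fps_ext) (auto simp: dilate_nth numeral_fps_const)

lemma dilate_X: "dilate fps_X = fps_X ^ 3"
  by (simp add: dilate_def)

lemmas dilate_simps = dilate_add dilate_diff dilate_uminus dilate_mult dilate_power dilate_0 dilate_1
  dilate_numeral dilate_X

lemma sect_combine:
  assumes "f = dilate f0 + fps_X * dilate f1 + fps_X ^ 2 * dilate f2"
  shows "sect 0 f = f0" "sect (Suc 0) f = f1" "sect 2 f = f2"
  by (rule fps_ext; simp add: assms sect_def fps_X_power_mult_nth dilate_nth; presburger)+

lemma mod_3_cases:
  fixes n :: nat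
  obtains m where "n = 3 * m" | m where "n = 3 * m + 1" | m where "n = 3 * m + 2"
proof -
  have "\<exists>m. n = 3 * m \<or> n = 3 * m + 1 \<or> n = 3 * m + 2" by presburger
  then show ?thesis using that by blast
qed

lemma sect_decompose:
  "f = dilate (sect 0 f) + fps_X * dilate (sect 1 f) + fps_X ^ 2 * dilate (sect 2 f)"
proof (rule fps_ext)
  fix n :: nat
  show "fps_nth f n = fps_nth (dilate (sect 0 f) + fps_X * dilate (sect 1 f) + fps_X ^ 2 * dilate (sect 2 f)) n"
    by (cases n rule: mod_3_cases)
       (simp add: sect_def fps_X_power_mult_nth dilate_nth; presburger)+
qed

lemma sect_mult:
  shows "sect 0 (f * g) = sect 0 f * sect 0 g + fps_X * (sect 1 f * sect 2 g + sect 2 f * sect 1 g)"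
    and "sect (Suc 0) (f * g) = sect 0 f * sect 1 g + sect 1 f * sect 0 g + fps_X * (sect 2 f * sect 2 g)"
    and "sect 2 (f * g) = sect 0 f * sect 2 g + sect 1 f * sect 1 g + sect 2 f * sect 0 g"
proof -
  have "f * g = (dilate (sect 0 f) + fps_X * dilate (sect 1 f) + fps_X ^ 2 * dilate (sect 2 f))
      * (dilate (sect 0 g) + fps_X * dilate (sect 1 g) + fps_X ^ 2 * dilate (sect 2 g))"
    using sect_decompose[of f] sect_decompose[of g] by simp
  also have "\<dots> = dilate (sect 0 f * sect 0 g + fps_X * (sect 1 f * sect 2 g + sect 2 f * sect 1 g))
      + fps_X * dilate (sect 0 f * sect 1 g + sect 1 f * sect 0 g + fps_X * (sect 2 f * sect 2 g))
      + fps_X ^ 2 * dilate (sect 0 f * sect 2 g + sect 1 f * sect 1 g + sect 2 f * sect 0 g)"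
    unfolding dilate_simps by (simp add: power2_eq_square power3_eq_cube algebra_simps)
  finally have *: "f * g = \<dots>" .
  from sect_combine[OF *]
  show "sect 0 (f * g) = sect 0 f * sect 0 g + fps_X * (sect 1 f * sect 2 g + sect 2 f * sect 1 g)"
    and "sect (Suc 0) (f * g) = sect 0 f * sect 1 g + sect 1 f * sect 0 g + fps_X * (sect 2 f * sect 2 g)"
    and "sect 2 (f * g) = sect 0 f * sect 2 g + sect 1 f * sect 1 g + sect 2 f * sect 0 g"
    by auto
qed

lemma sect_dilate: "sect 0 (dilate f) = f" "sect (Suc 0) (dilate f) = 0" "sect 2 (dilate f) = 0"
  using sect_combine[of "dilate f" f 0 0] by (simp_all add: dilate_simps)

lemma sect_0_mult_dilate: "sect 0 (f * dilate g) = sect 0 f * g"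
  by (simp add: sect_mult sect_dilate)

text \<open>
  The norm of \<open>f\<close> from the power series in \<open>q\<close> to those in \<open>q\<^sup>3\<close>, rewritten in terms of \<open>q\<close>: with a
  primitive cube root of unity \<open>\<omega>\<close> it is \<open>f(q) f(\<omega> q) f(\<omega>\<^sup>2 q)\<close>. The formula through the sections stays
  within the integers.
\<close>
definition norm3 :: "int fps \<Rightarrow> int fps" where
  "norm3 f = sect 0 f ^ 3 + fps_X * sect 1 f ^ 3 + fps_X ^ 2 * sect 2 f ^ 3
     - 3 * fps_X * sect 0 f * sect 1 f * sect 2 f"

lemma norm3_mult: "norm3 (f * g) = norm3 f * norm3 g"
  unfolding norm3_def One_nat_def sect_mult by algebra

lemma norm3_dilate: "norm3 (dilate f) = f ^ 3"
  by (simp add: norm3_def sect_dilate)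

lemma norm3_1: "norm3 1 = 1"
  using norm3_dilate[of 1] by (simp add: dilate_simps)

lemma norm3_prod: "norm3 (\<Prod>i\<in>I. f i) = (\<Prod>i\<in>I. norm3 (f i))"
  by (induction I rule: infinite_finite_induct) (simp_all add: norm3_1 norm3_mult)

lemma norm3_power: "norm3 (f ^ n) = norm3 f ^ n"
  by (induction n) (simp_all add: norm3_1 norm3_mult)

lemma agree_norm3:
  assumes "agree (3 * N) f g"
  shows "agree N (norm3 f) (norm3 g)"
proof -
  have "agree N (sect i f) (sect i g)" if "i < 3" for i
    using assms that by (simp add: agree_def sect_def)
  then have "agree N (sect 0 f) (sect 0 g)" "agree N (sect 1 f) (sect 1 g)" "agree N (sect 2 f) (sect 2 g)"
    by simp_all
  then show ?thesis unfolding norm3_def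
    by (intro agree_add agree_diff agree_mult agree_power agree_refl)
qed

text \<open>
  Multiplication by \<open>j\<close> permutes the residues modulo \<open>3\<close>, so this is
  \<open>(1 - x) (1 - \<omega> x) (1 - \<omega>\<^sup>2 x) = 1 - x\<^sup>3\<close> for \<open>x = q\<^sup>j\<close>, with \<open>q\<^sup>3\<close> renamed to \<open>q\<close>.
\<close>
lemma norm3_one_minus_X_power:
  assumes "\<not> 3 dvd j"
  shows "norm3 (1 - fps_X ^ j) = 1 - fps_X ^ j"
proof -
  have cube: "(fps_X ^ m) ^ 3 = (fps_X ^ (3 * m) :: int fps)" for m
    by (simp add: mult.commute[of 3] flip: power_mult)
  from assms consider m where "j = 3 * m + 1" | m where "j = 3 * m + 2"
    using mod_3_cases[of j] by (metis dvd_triv_left)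
  then show ?thesis
  proof cases
    case 1
    have "1 - fps_X ^ j = dilate 1 + fps_X * dilate (- (fps_X ^ m)) + fps_X ^ 2 * dilate 0"
      by (simp add: 1 dilate_simps power_add power_mult)
    from sect_combine[OF this] show ?thesis
      by (simp add: 1 norm3_def power_add cube)
  next
    case 2
    have "1 - fps_X ^ j = dilate 1 + fps_X * dilate 0 + fps_X ^ 2 * dilate (- (fps_X ^ m))"
      unfolding 2 power_add power_mult dilate_simps
      by (simp only: mult.commute mult_minus_right diff_conv_add_uminus mult_zero_right add_0_right)
    from sect_combine[OF this] have "norm3 (1 - fps_X ^ j) = 1 + fps_X ^ 2 * - (fps_X ^ (3 * m))"
      by (simp add: norm3_def cube)
    then show ?thesis unfolding 2 power_add by (simp only: mult.commute mult_minus_right diff_conv_add_uminus)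
  qed
qed

lemma norm3_qprod:
  assumes "k > 0" "\<not> 3 dvd r"
  shows "norm3 (qprod (- 1) (3 * k) r) = qprod (- 1) (3 * k) r"
proof (rule eq_if_agree)
  fix N
  have "agree N (norm3 (qprod (- 1) (3 * k) r)) (norm3 (\<Prod>m<3 * N. qfac (- 1) (3 * k) r m))"
    using assms by (intro agree_norm3 agree_qprod) auto
  also have "\<dots> = (\<Prod>m<3 * N. qfac (- 1) (3 * k) r m)"
    unfolding norm3_prod qfac_minus
  proof (intro prod.cong refl norm3_one_minus_X_power)
    fix m show "\<not> 3 dvd 3 * k * m + r"
      using assms(2) dvd_add_right_iff[of 3 "3 * k * m" r] by (simp add: mult.assoc)
  qed
  also have "agree N \<dots> (qprod (- 1) (3 * k) r)"
    using assms by (intro agree_sym[OF agree_qprod]) auto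
  finally show "agree N (norm3 (qprod (- 1) (3 * k) r)) (qprod (- 1) (3 * k) r)" .
qed

lemma dilate_qprod:
  assumes "k > 0"
  shows "dilate (qprod \<epsilon> k r) = qprod \<epsilon> (3 * k) (3 * r)"
proof (rule eq_if_agree)
  fix N
  have "agree N (dilate f) (dilate g)" if "agree N f g" for f g
    using that by (auto simp: agree_def dilate_nth)
  then have "agree N (dilate (qprod \<epsilon> k r)) (dilate (\<Prod>m<N. qfac \<epsilon> k r m))"
    using assms by (simp add: agree_qprod)
  also have "dilate (\<Prod>m<n. qfac \<epsilon> k r m) = (\<Prod>m<n. qfac \<epsilon> (3 * k) (3 * r) m)" for n
  proof (induction n)
    case (Suc n)
    have "dilate (fps_const \<epsilon>) = fps_const \<epsilon>" by (rule fps_ext) (auto simp: dilate_nth)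
    then have "dilate (qfac \<epsilon> k r n) = qfac \<epsilon> (3 * k) (3 * r) n"
      by (simp add: qfac_def dilate_simps algebra_simps flip: power_mult)
    then show ?case using Suc by (simp add: dilate_mult)
  qed (simp add: dilate_1)
  also have "agree N (\<Prod>m<N. qfac \<epsilon> (3 * k) (3 * r) m) (qprod \<epsilon> (3 * k) (3 * r))"
    using assms by (intro agree_sym[OF agree_qprod]) auto
  finally show "agree N (dilate (qprod \<epsilon> k r)) (qprod \<epsilon> (3 * k) (3 * r))" .
qed

text \<open>
  The factors with exponent prime to \<open>3\<close> keep their form under the norm, while those with exponent
  divisible by \<open>3\<close> are series in \<open>q\<^sup>3\<close> and contribute the cube of \<open>E k\<close>.
\<close>
lemma norm3_euler:
  assumes "\<not> 3 dvd k"
  shows "norm3 (E k) * E (3 * k) = E k ^ 4"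
proof -
  have k: "k > 0" using assms by (cases k) auto
  have split: "E k = qprod (- 1) (3 * k) k * qprod (- 1) (3 * k) (2 * k) * E (3 * k)"
    using qprod_split[of k 3 "- 1" k] k by (simp add: prod_lessThan_3 mult_ac flip: mult_2)
  have "\<not> 3 dvd 2 * k" using assms by presburger
  then have "norm3 (E k) = qprod (- 1) (3 * k) k * qprod (- 1) (3 * k) (2 * k) * E k ^ 3"
    using assms k norm3_dilate[of "E k"]
    by (subst split) (simp add: norm3_mult norm3_qprod dilate_qprod)
  then have "norm3 (E k) * E (3 * k) = (qprod (- 1) (3 * k) k * qprod (- 1) (3 * k) (2 * k) * E (3 * k)) * E k ^ 3"
    by (simp add: mult_ac)
  also have "\<dots> = E k ^ 4" by (simp flip: split) (simp add: eval_nat_numeral mult_ac)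
  finally show ?thesis .
qed

section \<open>The 3-dissections of the theta functions\<close>

text \<open>
  A section of a theta series is found by splitting the summation index \<open>k\<close> modulo \<open>3\<close>: the classes
  whose exponents have the right residue are reparametrised as index sets of another theta series, and in
  the other classes the equation for the exponent is impossible modulo \<open>3\<close>.
\<close>
lemma theta_exp_eq_iff:
  "theta_exp r s k = n \<longleftrightarrow> int r * (k * (k + 1)) + int s * (k * (k - 1)) = 2 * int n"
  using two_theta_exp[of r s k] by auto

lemma sect_theta_nth:
  "fps_nth (sect i (theta \<epsilon> r s)) n = (\<Sum>k | theta_exp r s k = 3 * n + i. theta_sign \<epsilon> k)"
  by (simp add: sect_def theta_def)

lemma int_mod_3_cases:
  fixes k :: int
  obtains j where "k = 3 * j" | j where "k = 3 * j + 1" | j where "k = 3 * j + 2"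
proof -
  have "\<exists>j. k = 3 * j \<or> k = 3 * j + 1 \<or> k = 3 * j + 2" by presburger
  then show ?thesis using that by blast
qed

lemma sum_two_images:
  fixes h u :: "int \<Rightarrow> int"
  assumes "finite S" "inj f" "inj g" "\<And>i j. f i \<noteq> g j"
    and "\<And>j. h (f j) = u j" "\<And>j. h (g j) = u j"
  shows "sum h (f ` S \<union> g ` S) = 2 * sum u S"
proof -
  have "sum h (f ` S \<union> g ` S) = sum h (f ` S) + sum h (g ` S)"
    using assms(1,4) by (intro sum.union_disjoint) auto
  also have "sum h (f ` S) = sum u S"
    using assms(2,5) by (subst sum.reindex) (auto intro: inj_on_subset)
  also have "sum h (g ` S) = sum u S"
    using assms(3,6) by (subst sum.reindex) (auto intro: inj_on_subset)
  finally show ?thesis by simp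
qed

lemma not_3_mult: "3 * x \<noteq> 2" "3 * x \<noteq> 4" "3 * x \<noteq> 8" for x :: int
  by presburger+

lemma fps_nth_double: "fps_nth (2 * f) n = 2 * fps_nth f n" for f :: "int fps"
  by (simp only: mult_2 fps_add_nth)

text \<open>
  The computation is done for the doubled series \<open>2 \<psi>(q)\<close>, whose exponents are \<open>k (k - 1) / 2\<close> with
  \<open>k\<close> an arbitrary integer. The symmetry \<open>k \<mapsto> 1 - k\<close> exchanges the classes \<open>0\<close> and \<open>1\<close>, which together
  give the section \<open>0\<close>; the class \<open>2\<close> gives the section \<open>1\<close>.
\<close>
lemma psi_sections:
  "sect 0 (psi 1) = theta 1 1 2" "sect (Suc 0) (psi 1) = psi 3" "sect 2 (psi 1) = 0"
proof -
  have psi: "2 * fps_nth (sect i (psi 1)) n = fps_nth (sect i (theta 1 0 1)) n" for i n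
    by (simp only: theta_0(1)[OF zero_less_one] sect_def fps_nth_Abs_fps fps_nth_double)
  have sign: "theta_sign 1 k = 1" for k by (simp add: theta_sign_def)
  show "sect 0 (psi 1) = theta 1 1 2"
  proof (rule fps_ext)
    fix n
    have "{k. theta_exp 0 1 k = 3 * n + 0}
        = (\<lambda>j. 3 * j) ` {j. theta_exp 1 2 j = n} \<union> (\<lambda>j. 1 - 3 * j) ` {j. theta_exp 1 2 j = n}"
      (is "?A = ?f ` ?S \<union> ?g ` ?S")
    proof (rule set_eqI)
      fix k :: int
      show "k \<in> ?A \<longleftrightarrow> k \<in> ?f ` ?S \<union> ?g ` ?S"
      proof (cases k rule: int_mod_3_cases)
        case (1 j)
        have "k \<in> ?A \<longleftrightarrow> j \<in> ?S" by (auto simp: theta_exp_eq_iff 1 algebra_simps)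
        moreover have "k \<in> ?f ` ?S \<longleftrightarrow> j \<in> ?S" by (auto simp: 1)
        moreover have "k \<notin> ?g ` ?S" unfolding 1 image_iff by presburger
        ultimately show ?thesis by blast
      next
        case (2 j)
        have "k \<in> ?A \<longleftrightarrow> - j \<in> ?S" by (auto simp: theta_exp_eq_iff 2 algebra_simps)
        moreover have "k \<in> ?g ` ?S \<longleftrightarrow> - j \<in> ?S"
        proof
          assume "k \<in> ?g ` ?S"
          then obtain i where "i \<in> ?S" "k = 1 - 3 * i" by blast
          moreover from this have "i = - j" using 2 by simp
          ultimately show "- j \<in> ?S" by simp
        next
          assume "- j \<in> ?S"
          then show "k \<in> ?g ` ?S" using 2 by (intro image_eqI[of _ _ "- j"]) auto
        qed
        moreover have "k \<notin> ?f ` ?S" unfolding 2 image_iff by presburger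
        ultimately show ?thesis by blast
      next
        case (3 j)
        have "k \<notin> ?A"
          using not_3_mult(1)[of "2 * int n - 3 * (j * j) - 3 * j"]
          by (auto simp: theta_exp_eq_iff 3 algebra_simps)
        moreover have "k \<notin> ?f ` ?S" "k \<notin> ?g ` ?S" unfolding 3 image_iff by presburger+
        ultimately show ?thesis by blast
      qed
    qed
    moreover have "(\<Sum>k\<in>?f ` ?S \<union> ?g ` ?S. theta_sign 1 k) = 2 * (\<Sum>j\<in>?S. theta_sign 1 j)"
    proof (rule sum_two_images)
      show "3 * i \<noteq> 1 - 3 * j" for i j :: int by presburger
    qed (auto simp: finite_theta_exp inj_def sign)
    ultimately have "2 * fps_nth (sect 0 (psi 1)) n = 2 * fps_nth (theta 1 1 2) n"
      unfolding psi sect_theta_nth by (simp add: theta_def)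
    then show "fps_nth (sect 0 (psi 1)) n = fps_nth (theta 1 1 2) n" by simp
  qed
  show "sect (Suc 0) (psi 1) = psi 3"
  proof (rule fps_ext)
    fix n
    have "{k. theta_exp 0 1 k = 3 * n + Suc 0} = (\<lambda>j. 3 * j + 2) ` {j. theta_exp 3 0 j = n}"
      (is "?A = ?f ` ?S")
    proof (rule set_eqI)
      fix k :: int
      show "k \<in> ?A \<longleftrightarrow> k \<in> ?f ` ?S"
      proof (cases k rule: int_mod_3_cases)
        case (1 j)
        have "k \<notin> ?A"
          using not_3_mult(1)[of "3 * (j * j) - j - 2 * int n"]
          by (auto simp: theta_exp_eq_iff 1 algebra_simps)
        moreover have "k \<notin> ?f ` ?S" unfolding 1 image_iff by presburger
        ultimately show ?thesis by blast
      next
        case (2 j)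
        have "k \<notin> ?A"
          using not_3_mult(1)[of "3 * (j * j) + j - 2 * int n"]
          by (auto simp: theta_exp_eq_iff 2 algebra_simps)
        moreover have "k \<notin> ?f ` ?S" unfolding 2 image_iff by presburger
        ultimately show ?thesis by blast
      next
        case (3 j)
        have "k \<in> ?A \<longleftrightarrow> j \<in> ?S" by (auto simp: theta_exp_eq_iff 3 algebra_simps)
        moreover have "k \<in> ?f ` ?S \<longleftrightarrow> j \<in> ?S" by (auto simp: 3)
        ultimately show ?thesis by blast
      qed
    qed
    moreover have "(\<Sum>k\<in>?f ` ?S. theta_sign 1 k) = (\<Sum>j\<in>?S. theta_sign 1 j)"
      by (subst sum.reindex) (auto simp: inj_on_def sign)
    ultimately have "2 * fps_nth (sect (Suc 0) (psi 1)) n = fps_nth (theta 1 3 0) n"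
      unfolding psi sect_theta_nth by (simp add: theta_def)
    also have "\<dots> = 2 * fps_nth (psi 3) n"
      by (simp only: theta_0(2)[OF zero_less_numeral] fps_nth_double)
    finally show "fps_nth (sect (Suc 0) (psi 1)) n = fps_nth (psi 3) n" by simp
  qed
  show "sect 2 (psi 1) = 0"
  proof (rule fps_ext)
    fix n
    have "{k. theta_exp 0 1 k = 3 * n + 2} = {}"
    proof (intro equals0I)
      fix k assume "k \<in> {k. theta_exp 0 1 k = 3 * n + 2}"
      then have eq: "k * (k - 1) = 6 * int n + 4" by (simp add: theta_exp_eq_iff)
      show False
      proof (cases k rule: int_mod_3_cases)
        case (1 j)
        show ?thesis using eq not_3_mult(2)[of "3 * (j * j) - j - 2 * int n"] by (simp add: 1 algebra_simps)
      next
        case (2 j)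
        show ?thesis using eq not_3_mult(2)[of "3 * (j * j) + j - 2 * int n"] by (simp add: 2 algebra_simps)
      next
        case (3 j)
        show ?thesis using eq not_3_mult(1)[of "3 * (j * j) + 3 * j - 2 * int n"] by (simp add: 3 algebra_simps)
      qed
    qed
    then have "2 * fps_nth (sect 2 (psi 1)) n = 0"
      unfolding psi sect_theta_nth by simp
    then show "fps_nth (sect 2 (psi 1)) n = fps_nth 0 n" by simp
  qed
qed

text \<open>
  Here the exponents are the squares \<open>k k\<close>. The classes \<open>1\<close> and \<open>2\<close> are exchanged by \<open>k \<mapsto> - k\<close> and
  together give the section \<open>1\<close>, with a sign because \<open>3 j + 1\<close> and \<open>j\<close> have opposite parity.
\<close>
lemma phi_sections:
  "sect 0 (theta (- 1) 1 1) = theta (- 1) 3 3"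
  "sect (Suc 0) (theta (- 1) 1 1) = - (2 * theta (- 1) 5 1)"
  "sect 2 (theta (- 1) 1 1) = 0"
proof -
  show "sect 0 (theta (- 1) 1 1) = theta (- 1) 3 3"
  proof (rule fps_ext)
    fix n
    have "{k. theta_exp 1 1 k = 3 * n + 0} = (\<lambda>j. 3 * j) ` {j. theta_exp 3 3 j = n}"
      (is "?A = ?f ` ?S")
    proof (rule set_eqI)
      fix k :: int
      show "k \<in> ?A \<longleftrightarrow> k \<in> ?f ` ?S"
      proof (cases k rule: int_mod_3_cases)
        case (1 j)
        have "k \<in> ?A \<longleftrightarrow> j \<in> ?S" by (auto simp: theta_exp_eq_iff 1 algebra_simps)
        moreover have "k \<in> ?f ` ?S \<longleftrightarrow> j \<in> ?S" by (auto simp: 1)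
        ultimately show ?thesis by blast
      next
        case (2 j)
        have "k \<notin> ?A"
          using not_3_mult(1)[of "2 * int n - 6 * (j * j) - 4 * j"]
          by (auto simp: theta_exp_eq_iff 2 algebra_simps)
        moreover have "k \<notin> ?f ` ?S" unfolding 2 image_iff by presburger
        ultimately show ?thesis by blast
      next
        case (3 j)
        have "k \<notin> ?A"
          using not_3_mult(3)[of "2 * int n - 6 * (j * j) - 8 * j"]
          by (auto simp: theta_exp_eq_iff 3 algebra_simps)
        moreover have "k \<notin> ?f ` ?S" unfolding 3 image_iff by presburger
        ultimately show ?thesis by blast
      qed
    qed
    moreover have "(\<Sum>k\<in>?f ` ?S. theta_sign (- 1) k) = (\<Sum>j\<in>?S. theta_sign (- 1) j)"
      by (subst sum.reindex) (auto simp: inj_on_def theta_sign_def)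
    ultimately show "fps_nth (sect 0 (theta (- 1) 1 1)) n = fps_nth (theta (- 1) 3 3) n"
      unfolding sect_theta_nth by (simp add: theta_def)
  qed
  show "sect (Suc 0) (theta (- 1) 1 1) = - (2 * theta (- 1) 5 1)"
  proof (rule fps_ext)
    fix n
    have "{k. theta_exp 1 1 k = 3 * n + Suc 0}
        = (\<lambda>j. 3 * j + 1) ` {j. theta_exp 5 1 j = n} \<union> (\<lambda>j. - (3 * j + 1)) ` {j. theta_exp 5 1 j = n}"
      (is "?A = ?f ` ?S \<union> ?g ` ?S")
    proof (rule set_eqI)
      fix k :: int
      show "k \<in> ?A \<longleftrightarrow> k \<in> ?f ` ?S \<union> ?g ` ?S"
      proof (cases k rule: int_mod_3_cases)
        case (1 j)
        have "k \<notin> ?A"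
          using not_3_mult(1)[of "6 * (j * j) - 2 * int n"]
          by (auto simp: theta_exp_eq_iff 1 algebra_simps)
        moreover have "k \<notin> ?f ` ?S" "k \<notin> ?g ` ?S" unfolding 1 image_iff by presburger+
        ultimately show ?thesis by blast
      next
        case (2 j)
        have "k \<in> ?A \<longleftrightarrow> j \<in> ?S" by (auto simp: theta_exp_eq_iff 2 algebra_simps)
        moreover have "k \<in> ?f ` ?S \<longleftrightarrow> j \<in> ?S" by (auto simp: 2)
        moreover have "k \<notin> ?g ` ?S" unfolding 2 image_iff by presburger
        ultimately show ?thesis by blast
      next
        case (3 j)
        have "k \<in> ?A \<longleftrightarrow> - j - 1 \<in> ?S" by (auto simp: theta_exp_eq_iff 3 algebra_simps)
        moreover have "k \<in> ?g ` ?S \<longleftrightarrow> - j - 1 \<in> ?S"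
        proof
          assume "k \<in> ?g ` ?S"
          then obtain i where "i \<in> ?S" "k = - (3 * i + 1)" by blast
          moreover from this have "i = - j - 1" using 3 by simp
          ultimately show "- j - 1 \<in> ?S" by simp
        next
          assume "- j - 1 \<in> ?S"
          then show "k \<in> ?g ` ?S" using 3 by (intro image_eqI[of _ _ "- j - 1"]) auto
        qed
        moreover have "k \<notin> ?f ` ?S" unfolding 3 image_iff by presburger
        ultimately show ?thesis by blast
      qed
    qed
    moreover have "(\<Sum>k\<in>?f ` ?S \<union> ?g ` ?S. theta_sign (- 1) k) = 2 * (\<Sum>j\<in>?S. - theta_sign (- 1) j)"
    proof (rule sum_two_images)
      show "3 * i + 1 \<noteq> - (3 * j + 1)" for i j :: int by presburger
    qed (auto simp: finite_theta_exp inj_def theta_sign_def)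
    moreover have "fps_nth (- (2 * theta (- 1) 5 1)) n = - 2 * fps_nth (theta (- 1) 5 1) n"
      by (simp only: fps_neg_nth fps_nth_double mult_minus_left)
    ultimately show "fps_nth (sect (Suc 0) (theta (- 1) 1 1)) n = fps_nth (- (2 * theta (- 1) 5 1)) n"
      unfolding sect_theta_nth by (simp add: theta_def sum_negf)
  qed
  show "sect 2 (theta (- 1) 1 1) = 0"
  proof (rule fps_ext)
    fix n
    have "{k. theta_exp 1 1 k = 3 * n + 2} = {}"
    proof (intro equals0I)
      fix k assume "k \<in> {k. theta_exp 1 1 k = 3 * n + 2}"
      then have eq: "k * k = 3 * int n + 2" by (simp add: theta_exp_eq_iff algebra_simps)
      show False
      proof (cases k rule: int_mod_3_cases)
        case (1 j)
        show ?thesis using eq not_3_mult(1)[of "3 * (j * j) - int n"] by (simp add: 1 algebra_simps)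
      next
        case (2 j)
        show ?thesis using eq not_3_mult(2)[of "3 * (j * j) + 2 * j - int n + 1"] by (simp add: 2 algebra_simps)
      next
        case (3 j)
        show ?thesis using eq not_3_mult(1)[of "int n - 3 * (j * j) - 4 * j"] by (simp add: 3 algebra_simps)
      qed
    qed
    then show "fps_nth (sect 2 (theta (- 1) 1 1)) n = fps_nth 0 n"
      unfolding sect_theta_nth by simp
  qed
qed

text \<open>The pentagonal numbers \<open>(3 k k - k) / 2\<close> are congruent to \<open>0\<close>, \<open>1\<close> or \<open>2\<close> modulo \<open>5\<close>.\<close>
lemma euler_nth_eq_0:
  assumes "n mod 5 \<in> {3, 4}"
  shows "fps_nth (E 1) n = 0"
proof -
  have "{k. theta_exp 1 2 k = n} = {}"
  proof (intro equals0I)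
    fix k assume "k \<in> {k. theta_exp 1 2 k = n}"
    then have eq: "3 * (k * k) - k = 2 * int n" by (simp add: theta_exp_eq_iff algebra_simps)
    from assms have "int n mod 5 \<in> {3, 4}" by simp presburger
    define j where "j = k div 5"
    define i where "i = k mod 5"
    have k: "k = 5 * j + i" by (simp add: i_def j_def)
    have i: "i \<in> {0, 1, 2, 3, 4}" unfolding i_def by simp presburger
    define m where "m = 15 * (j * j) + 6 * i * j - j"
    have "5 * m + 3 * (i * i) - i = 2 * int n"
      using eq by (simp add: k m_def algebra_simps)
    then have "(5 * m + 3 * (i * i) - i) mod 5 = (2 * int n) mod 5" by simp
    then show False using i \<open>int n mod 5 \<in> {3, 4}\<close> by auto presburger+
  qed
  then show ?thesis unfolding euler_triple[symmetric] theta_def by simp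
qed

section \<open>Trisecting the generating function\<close>
lemma E_nth_0: "k > 0 \<Longrightarrow> fps_nth (E k) 0 = 1"
  by (simp add: qprod_nth_0)

lemma E_nonzero: "k > 0 \<Longrightarrow> E k \<noteq> 0"
  using E_nth_0[of k] by auto

text \<open>
  The names stand for the nonzero sections: \<open>\<psi>(q) = a(q\<^sup>3) + q b(q\<^sup>3)\<close> and
  \<open>\<phi>(- q) = d(q\<^sup>3) - 2 q e(q\<^sup>3)\<close>.
\<close>
context
  fixes a b d e :: "int fps"
  defines "a \<equiv> theta 1 1 2" and "b \<equiv> psi 3" and "d \<equiv> theta (- 1) 3 3" and "e \<equiv> theta (- 1) 5 1"
begin

lemma a_eta: "a * E 1 * E 6 = E 2 * E 3 ^ 2"
  unfolding a_def by (rule theta_1_2_eta)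

lemma b_eta: "b * E 3 = E 6 ^ 2"
  using psi_eta[of 3] by (simp add: b_def)

lemma d_eta: "d * E 6 = E 3 ^ 2"
  using phi_eta[of 3] by (simp add: d_def)

lemma e_eta: "e * E 2 * E 3 = E 1 * E 6 ^ 2"
  unfolding e_def by (rule theta_5_1_eta)

lemma d_nonzero: "d \<noteq> 0"
  using d_eta E_nonzero[of 3] by auto

text \<open>
  Because of this relation \<open>\<phi>(- q)\<close> is, up to a factor in \<open>q\<^sup>3\<close>, a linear form in the same two series
  as \<open>\<psi>(q)\<close>; see the lemma \<open>phi_factor\<close> below.
\<close>
lemma ae_eq_bd: "a * e = b * d"
proof -
  have "(a * e) * (E 1 * E 2 * E 3 * E 6) = (a * E 1 * E 6) * (e * E 2 * E 3)" by algebra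
  also have "\<dots> = E 1 * E 2 * (E 3 ^ 2) * (E 6 ^ 2)" unfolding a_eta e_eta by algebra
  also have "\<dots> = (b * d) * (E 1 * E 2 * E 3 * E 6)" unfolding b_eta[symmetric] d_eta[symmetric] by algebra
  finally show ?thesis using E_nonzero by simp
qed

lemma a_E1: "a * E 1 = d * E 2"
proof -
  have "(a * E 1) * E 6 = (d * E 2) * E 6" unfolding a_eta using d_eta by algebra
  then show ?thesis using E_nonzero[of 6] by simp
qed

text \<open>
  With \<open>\<alpha> = a(q\<^sup>3)\<close> and \<open>\<beta> = q b(q\<^sup>3)\<close> these are the norms of \<open>\<alpha> - 2 \<beta>\<close> and of \<open>\<alpha> + \<beta>\<close>. They serve as the
  rationalised denominators when one divides by \<open>\<phi>(- q)\<close> and \<open>\<psi>(q)\<close>.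
\<close>
definition "L = a ^ 3 - 8 * fps_X * b ^ 3"
definition "R = a ^ 3 + fps_X * b ^ 3"

lemma psi_dissection: "psi 1 = dilate a + fps_X * dilate b"
  using sect_decompose[of "psi 1"] psi_sections by (simp add: a_def b_def dilate_simps)

lemma phi_dissection: "theta (- 1) 1 1 = dilate d - 2 * fps_X * dilate e"
  using sect_decompose[of "theta (- 1) 1 1"] phi_sections by (simp add: d_def e_def dilate_simps)

lemma phi_factor: "dilate a * theta (- 1) 1 1 = dilate d * (dilate a - 2 * (fps_X * dilate b))"
proof -
  have "dilate a * dilate e = dilate b * dilate d"
    using ae_eq_bd by (simp flip: dilate_mult)
  then show ?thesis unfolding phi_dissection by algebra
qed

lemma norm3_phi: "d ^ 3 * L = a ^ 3 * norm3 (theta (- 1) 1 1)"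
proof -
  have "norm3 (theta (- 1) 1 1) = d ^ 3 - 8 * fps_X * e ^ 3"
    using phi_sections by (simp add: norm3_def d_def e_def power_mult_distrib)
  moreover have "(a * e) ^ 3 = (b * d) ^ 3" by (simp add: ae_eq_bd)
  ultimately show ?thesis unfolding L_def by (simp add: power_mult_distrib) algebra
qed

lemma norm3_psi: "norm3 (psi 1) = R"
  using psi_sections by (simp add: norm3_def a_def b_def R_def)

lemma psi_E: "psi 1 * E 1 = E 2 ^ 2"
  using psi_eta[of 1] by simp

lemma phi_E: "theta (- 1) 1 1 * E 2 = E 1 ^ 2"
  using phi_eta[of 1] by simp

lemma norm3_E1: "norm3 (E 1) * E 3 = E 1 ^ 4"
  using norm3_euler[of 1] by simp

lemma norm3_E2: "norm3 (E 2) * E 6 = E 2 ^ 4"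
  using norm3_euler[of 2] by simp

text \<open>
  The norm is known on Euler products, so taking norms in \<open>\<psi>(q) E\<^sub>1 = E\<^sub>2\<^sup>2\<close> and in
  \<open>\<phi>(- q) E\<^sub>2 = E\<^sub>1\<^sup>2\<close> evaluates both denominators as eta quotients.
\<close>
lemma R_eta: "R * E 1 ^ 4 * E 6 ^ 2 = E 2 ^ 8 * E 3"
proof -
  have "R * norm3 (E 1) = norm3 (E 2) ^ 2"
    unfolding norm3_psi[symmetric] norm3_mult[symmetric] psi_E by (rule norm3_power)
  then have "R * (norm3 (E 1) * E 3) * E 6 ^ 2 = (norm3 (E 2) * E 6) ^ 2 * E 3" by algebra
  then show ?thesis unfolding norm3_E1 norm3_E2 by algebra
qed

lemma L_eta: "L * E 2 * E 3 ^ 2 = E 1 ^ 5 * E 6"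
proof -
  define n where "n = norm3 (theta (- 1) 1 1)"
  have "n * norm3 (E 2) = norm3 (E 1) ^ 2"
    unfolding n_def norm3_mult[symmetric] phi_E by (rule norm3_power)
  then have "n * (norm3 (E 2) * E 6) * E 3 ^ 2 = (norm3 (E 1) * E 3) ^ 2 * E 6" by algebra
  then have n: "n * E 2 ^ 4 * E 3 ^ 2 = E 1 ^ 8 * E 6" unfolding norm3_E1 norm3_E2 by algebra
  have "(L * E 2 * E 3 ^ 2) * (d ^ 3 * E 1 ^ 3 * E 2 ^ 3) = (d ^ 3 * L) * E 1 ^ 3 * E 2 ^ 4 * E 3 ^ 2"
    by algebra
  also have "\<dots> = (a * E 1) ^ 3 * (n * E 2 ^ 4 * E 3 ^ 2)"
    unfolding norm3_phi n_def by algebra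
  also have "\<dots> = (E 1 ^ 5 * E 6) * (d ^ 3 * E 1 ^ 3 * E 2 ^ 3)"
    unfolding n a_E1 by algebra
  finally show ?thesis using E_nonzero d_nonzero by simp
qed

lemma sect_0_X_mult: "sect 0 (fps_X * f) = fps_X * sect 2 f"
proof -
  have "fps_X = dilate 0 + fps_X * dilate 1 + fps_X ^ 2 * dilate 0" by (simp add: dilate_simps)
  from sect_combine[OF this] show ?thesis by (simp add: sect_mult)
qed

lemma dilate_L_R:
  "dilate L = dilate a ^ 3 - 8 * (fps_X * dilate b) ^ 3"
  "dilate R = dilate a ^ 3 + (fps_X * dilate b) ^ 3"
  unfolding L_def R_def dilate_simps by algebra+

lemma dilate_E: "k > 0 \<Longrightarrow> dilate (E k) = E (3 * k)"
  by (simp add: dilate_qprod)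

text \<open>
  Division by \<open>E\<^sub>1 E\<^sub>2 = \<phi>(- q) \<psi>(q)\<close> amounts to division by \<open>(\<alpha> - 2 \<beta>) (\<alpha> + \<beta>)\<close>. The complementary factor
  expands into monomials in \<open>\<alpha>\<close> and \<open>\<beta>\<close>, and a monomial with \<open>\<beta>\<^sup>j\<close> has only exponents congruent to \<open>j\<close>
  modulo \<open>3\<close>. The extra factor \<open>q\<close> in the numerator selects \<open>j = 2\<close>, where the coefficient is \<open>3\<close>.
\<close>
lemma sect_0_gf:
  assumes "f * (E 1 * E 2) = fps_X * E 6 ^ 3"
  shows "sect 0 f * E 1 ^ 4 * E 2 = 3 * fps_X * E 3 ^ 3 * E 6 ^ 3"
proof -
  define \<alpha> where "\<alpha> = dilate a"
  define \<beta> where "\<beta> = fps_X * dilate b"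
  have "theta (- 1) 1 1 * psi 1 * (E 1 * E 2) = (E 1 * E 2) * (E 1 * E 2)"
    using psi_E phi_E by algebra
  then have phi_psi: "theta (- 1) 1 1 * psi 1 = E 1 * E 2" using E_nonzero by simp
  have "f * dilate d * (\<alpha> - 2 * \<beta>) * (\<alpha> + \<beta>) = f * (theta (- 1) 1 1 * psi 1) * \<alpha>"
    using phi_factor unfolding \<alpha>_def \<beta>_def psi_dissection by algebra
  also have "\<dots> = fps_X * E 6 ^ 3 * \<alpha>" unfolding phi_psi assms ..
  finally have 1: "f * dilate d * (\<alpha> - 2 * \<beta>) * (\<alpha> + \<beta>) = fps_X * E 6 ^ 3 * \<alpha>" .
  have "f * dilate (d * L * R) = f * dilate d * (\<alpha> - 2 * \<beta>) * (\<alpha> + \<beta>)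
      * ((\<alpha> ^ 2 + 2 * \<alpha> * \<beta> + 4 * \<beta> ^ 2) * (\<alpha> ^ 2 - \<alpha> * \<beta> + \<beta> ^ 2))"
    unfolding dilate_mult dilate_L_R \<alpha>_def[symmetric] \<beta>_def[symmetric] by algebra
  also have "\<dots> = fps_X * (\<alpha> * (\<alpha> ^ 2 + 2 * \<alpha> * \<beta> + 4 * \<beta> ^ 2) * (\<alpha> ^ 2 - \<alpha> * \<beta> + \<beta> ^ 2) * E 6 ^ 3)"
    unfolding 1 by algebra
  also have "E 6 ^ 3 = dilate (E 2 ^ 3)" by (simp add: dilate_power dilate_E)
  finally have 2: "f * dilate (d * L * R) = fps_X * (\<alpha> * (\<alpha> ^ 2 + 2 * \<alpha> * \<beta> + 4 * \<beta> ^ 2)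
      * (\<alpha> ^ 2 - \<alpha> * \<beta> + \<beta> ^ 2) * dilate (E 2 ^ 3))" .
  have "\<alpha> * (\<alpha> ^ 2 + 2 * \<alpha> * \<beta> + 4 * \<beta> ^ 2) * (\<alpha> ^ 2 - \<alpha> * \<beta> + \<beta> ^ 2)
      = \<alpha> ^ 5 + \<alpha> ^ 4 * \<beta> + 3 * \<alpha> ^ 3 * \<beta> ^ 2 - 2 * \<alpha> ^ 2 * \<beta> ^ 3 + 4 * \<alpha> * \<beta> ^ 4" by algebra
  also have "\<dots> = dilate (a ^ 5 - 2 * fps_X * a ^ 2 * b ^ 3)
      + fps_X * dilate (a ^ 4 * b + 4 * fps_X * a * b ^ 4) + fps_X ^ 2 * dilate (3 * a ^ 3 * b ^ 2)"
    unfolding dilate_simps \<alpha>_def \<beta>_def by algebra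
  finally have "sect 2 (\<alpha> * (\<alpha> ^ 2 + 2 * \<alpha> * \<beta> + 4 * \<beta> ^ 2) * (\<alpha> ^ 2 - \<alpha> * \<beta> + \<beta> ^ 2)) = 3 * a ^ 3 * b ^ 2"
    by (rule sect_combine(3))
  then have 3: "sect 0 f * (d * L * R) = fps_X * (3 * a ^ 3 * b ^ 2 * E 2 ^ 3)"
    using arg_cong[OF 2, of "sect 0"] unfolding sect_0_mult_dilate sect_0_X_mult
    by (simp add: sect_mult sect_dilate)
  have "(sect 0 f * E 1 ^ 4 * E 2) * (d * E 1 ^ 4 * E 2 ^ 7 * E 3 * E 6)
      = 3 * fps_X * E 3 ^ 3 * E 6 ^ 3 * (d * E 1 ^ 4 * E 2 ^ 7 * E 3 * E 6)"
  proof -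
    have "(sect 0 f * E 1 ^ 4 * E 2) * (d * E 1 ^ 4 * E 2 ^ 7 * E 3 * E 6)
        = sect 0 f * d * (E 1 ^ 5 * E 6) * (E 2 ^ 8 * E 3) * E 1 ^ 3" by algebra
    also have "\<dots> = (sect 0 f * (d * L * R)) * (E 1 ^ 7 * E 2 * E 3 ^ 2 * E 6 ^ 2)"
      unfolding L_eta[symmetric] R_eta[symmetric] by algebra
    also have "\<dots> = 3 * fps_X * (a * E 1) ^ 3 * (b * E 3) ^ 2 * E 1 ^ 4 * E 2 ^ 4 * E 6 ^ 2"
      unfolding 3 by algebra
    also have "\<dots> = 3 * fps_X * (d * E 6) ^ 2 * d * E 1 ^ 4 * E 2 ^ 7 * E 6 ^ 4"
      unfolding a_E1 b_eta by algebra
    also have "\<dots> = 3 * fps_X * E 3 ^ 3 * E 6 ^ 3 * (d * E 1 ^ 4 * E 2 ^ 7 * E 3 * E 6)"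
      unfolding d_eta by algebra
    finally show ?thesis .
  qed
  then show ?thesis using E_nonzero d_nonzero by simp
qed

text \<open>
  The same method for \<open>E\<^sub>1\<^sup>4 E\<^sub>2 = \<phi>(- q)\<^sup>3 \<psi>(q)\<^sup>2\<close>. The relevant coefficients of the complementary factor, those
  at \<open>\<beta>\<^sup>2\<close>, \<open>\<beta>\<^sup>5\<close> and \<open>\<beta>\<^sup>8\<close>, are \<open>15\<close>, \<open>30\<close> and \<open>96\<close>, so that modulo \<open>5\<close> a single eta quotient remains;
  \<open>288\<close> is \<open>3 * 96\<close>.
\<close>
lemma sect_0_sect_0_gf:
  assumes "f * E 1 ^ 4 * E 2 = 3 * fps_X * E 3 ^ 3 * E 6 ^ 3"
  shows "\<exists>w. sect 0 f * E 1 ^ 9 * E 2 ^ 5 = 288 * fps_X ^ 3 * E 6 ^ 15 + 5 * w"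
proof -
  define \<alpha> where "\<alpha> = dilate a"
  define \<beta> where "\<beta> = fps_X * dilate b"
  define \<phi> where "\<phi> = theta (- 1) 1 1"
  \<comment> \<open>The factor \<open>\<alpha>\<^sup>3\<close> comes from replacing \<open>\<phi>(- q)\<close> by \<open>\<alpha> \<phi>(- q) = d(q\<^sup>3) (\<alpha> - 2 \<beta>)\<close> three times.\<close>
  define K where "K = \<alpha> ^ 3 * (\<alpha> ^ 2 + 2 * \<alpha> * \<beta> + 4 * \<beta> ^ 2) ^ 3 * (\<alpha> ^ 2 - \<alpha> * \<beta> + \<beta> ^ 2) ^ 2"
  have "\<phi> ^ 3 * psi 1 ^ 2 * (E 1 ^ 2 * E 2 ^ 3) = (\<phi> * E 2) ^ 3 * (psi 1 * E 1) ^ 2" by algebra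
  also have "\<dots> = (E 1 ^ 4 * E 2) * (E 1 ^ 2 * E 2 ^ 3)" unfolding \<phi>_def psi_E phi_E by algebra
  finally have phi_psi: "\<phi> ^ 3 * psi 1 ^ 2 = E 1 ^ 4 * E 2" using E_nonzero by simp
  have "f * dilate d ^ 3 * (\<alpha> - 2 * \<beta>) ^ 3 * (\<alpha> + \<beta>) ^ 2 = f * (dilate d * (\<alpha> - 2 * \<beta>)) ^ 3 * psi 1 ^ 2"
    unfolding psi_dissection \<alpha>_def \<beta>_def by algebra
  also have "dilate d * (\<alpha> - 2 * \<beta>) = \<alpha> * \<phi>"
    unfolding \<alpha>_def \<beta>_def \<phi>_def phi_factor ..
  also have "f * (\<alpha> * \<phi>) ^ 3 * psi 1 ^ 2 = f * (\<phi> ^ 3 * psi 1 ^ 2) * \<alpha> ^ 3" by algebra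
  also have "\<dots> = 3 * fps_X * E 3 ^ 3 * E 6 ^ 3 * \<alpha> ^ 3"
    unfolding phi_psi using assms by algebra
  finally have 1: "f * dilate d ^ 3 * (\<alpha> - 2 * \<beta>) ^ 3 * (\<alpha> + \<beta>) ^ 2 = 3 * fps_X * E 3 ^ 3 * E 6 ^ 3 * \<alpha> ^ 3" .
  have "f * dilate (d ^ 3 * L ^ 3 * R ^ 2) = f * dilate d ^ 3
      * ((\<alpha> - 2 * \<beta>) * (\<alpha> ^ 2 + 2 * \<alpha> * \<beta> + 4 * \<beta> ^ 2)) ^ 3 * ((\<alpha> + \<beta>) * (\<alpha> ^ 2 - \<alpha> * \<beta> + \<beta> ^ 2)) ^ 2"
  proof -
    have "dilate L = (\<alpha> - 2 * \<beta>) * (\<alpha> ^ 2 + 2 * \<alpha> * \<beta> + 4 * \<beta> ^ 2)"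
      "dilate R = (\<alpha> + \<beta>) * (\<alpha> ^ 2 - \<alpha> * \<beta> + \<beta> ^ 2)"
      unfolding dilate_L_R \<alpha>_def[symmetric] \<beta>_def[symmetric] by algebra+
    then show ?thesis by (simp add: dilate_mult dilate_power mult_ac)
  qed
  also have "\<dots> = f * dilate d ^ 3 * (\<alpha> - 2 * \<beta>) ^ 3 * (\<alpha> + \<beta>) ^ 2
      * ((\<alpha> ^ 2 + 2 * \<alpha> * \<beta> + 4 * \<beta> ^ 2) ^ 3 * (\<alpha> ^ 2 - \<alpha> * \<beta> + \<beta> ^ 2) ^ 2)"
    by (simp only: power_mult_distrib mult_ac)
  also have "\<dots> = fps_X * (K * (3 * E 3 ^ 3 * E 6 ^ 3))"
    unfolding 1 K_def by (simp only: mult_ac)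
  also have "3 * E 3 ^ 3 * E 6 ^ 3 = dilate (3 * E 1 ^ 3 * E 2 ^ 3)" by (simp add: dilate_simps dilate_E)
  finally have 2: "f * dilate (d ^ 3 * L ^ 3 * R ^ 2) = fps_X * (K * dilate (3 * E 1 ^ 3 * E 2 ^ 3))" .
  have "K = \<alpha> ^ 13 + 4 * \<alpha> ^ 12 * \<beta> + 15 * \<alpha> ^ 11 * \<beta> ^ 2 + 24 * \<alpha> ^ 10 * \<beta> ^ 3 + 45 * \<alpha> ^ 9 * \<beta> ^ 4
      + 30 * \<alpha> ^ 8 * \<beta> ^ 5 + 72 * \<alpha> ^ 7 * \<beta> ^ 6 + 24 * \<alpha> ^ 6 * \<beta> ^ 7 + 96 * \<alpha> ^ 5 * \<beta> ^ 8
      - 32 * \<alpha> ^ 4 * \<beta> ^ 9 + 64 * \<alpha> ^ 3 * \<beta> ^ 10"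
    unfolding K_def by algebra
  also have "\<dots> = dilate (a ^ 13 + 24 * fps_X * a ^ 10 * b ^ 3 + 72 * fps_X ^ 2 * a ^ 7 * b ^ 6 - 32 * fps_X ^ 3 * a ^ 4 * b ^ 9)
      + fps_X * dilate (4 * a ^ 12 * b + 45 * fps_X * a ^ 9 * b ^ 4 + 24 * fps_X ^ 2 * a ^ 6 * b ^ 7 + 64 * fps_X ^ 3 * a ^ 3 * b ^ 10)
      + fps_X ^ 2 * dilate (15 * a ^ 11 * b ^ 2 + 30 * fps_X * a ^ 8 * b ^ 5 + 96 * fps_X ^ 2 * a ^ 5 * b ^ 8)"
    unfolding dilate_simps \<alpha>_def \<beta>_def by algebra
  finally have "sect 2 K = 15 * a ^ 11 * b ^ 2 + 30 * fps_X * a ^ 8 * b ^ 5 + 96 * fps_X ^ 2 * a ^ 5 * b ^ 8"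
    by (rule sect_combine(3))
  then have 3: "sect 0 f * (d ^ 3 * L ^ 3 * R ^ 2)
      = fps_X * ((15 * a ^ 11 * b ^ 2 + 30 * fps_X * a ^ 8 * b ^ 5 + 96 * fps_X ^ 2 * a ^ 5 * b ^ 8) * (3 * E 1 ^ 3 * E 2 ^ 3))"
    using arg_cong[OF 2, of "sect 0"] unfolding sect_0_mult_dilate sect_0_X_mult
    by (simp add: sect_mult sect_dilate)
  \<comment> \<open>\<open>T\<close> is chosen so that, after multiplication by it, \<open>L\<close>, \<open>R\<close>, \<open>a\<close> and \<open>b\<close> occur only in combinations
      with known eta quotients; \<open>S\<close> is the factor common to both sides. It has constant coefficient
      \<open>1\<close> and is therefore invertible over the integers.\<close>
  define S where "S = d ^ 3 * E 1 ^ 11 * E 2 ^ 11 * E 3 ^ 10 * E 6 ^ 5"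
  define T where "T = E 1 ^ 13 * E 2 ^ 3 * E 3 ^ 14 * E 6 ^ 6"
  have "S * (sect 0 f * E 1 ^ 9 * E 2 ^ 5)
      = sect 0 f * d ^ 3 * (E 1 ^ 5 * E 6) ^ 3 * (E 2 ^ 8 * E 3) ^ 2 * (E 1 ^ 5 * E 3 ^ 8 * E 6 ^ 2)"
    unfolding S_def by algebra
  also have "\<dots> = (sect 0 f * (d ^ 3 * L ^ 3 * R ^ 2)) * T"
    unfolding L_eta[symmetric] R_eta[symmetric] T_def by algebra
  also have "\<dots> = 5 * ((9 * fps_X * a ^ 11 * b ^ 2 + 18 * fps_X ^ 2 * a ^ 8 * b ^ 5) * E 1 ^ 3 * E 2 ^ 3 * T)
      + 288 * fps_X ^ 3 * (a ^ 5 * b ^ 8 * E 1 ^ 3 * E 2 ^ 3 * T)"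
    unfolding 3 by algebra
  also have "a ^ 5 * b ^ 8 * E 1 ^ 3 * E 2 ^ 3 * T
      = (a * E 1) ^ 5 * (b * E 3) ^ 8 * (E 1 ^ 11 * E 2 ^ 6 * E 3 ^ 6 * E 6 ^ 6)"
    unfolding T_def by algebra
  also have "\<dots> = (d * E 6) ^ 2 * (d ^ 3 * E 1 ^ 11 * E 2 ^ 11 * E 3 ^ 6 * E 6 ^ 20)"
    unfolding a_E1 b_eta by algebra
  also have "\<dots> = S * E 6 ^ 15"
    unfolding d_eta S_def by algebra
  finally have 4: "S * (sect 0 f * E 1 ^ 9 * E 2 ^ 5)
      = 5 * ((9 * fps_X * a ^ 11 * b ^ 2 + 18 * fps_X ^ 2 * a ^ 8 * b ^ 5) * E 1 ^ 3 * E 2 ^ 3 * T)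
        + 288 * fps_X ^ 3 * (S * E 6 ^ 15)" .
  define v where "v = (9 * fps_X * a ^ 11 * b ^ 2 + 18 * fps_X ^ 2 * a ^ 8 * b ^ 5) * E 1 ^ 3 * E 2 ^ 3 * T"
  have "fps_nth (d * E 6) 0 = 1"
    unfolding d_eta by (simp add: fps_power_zeroth E_nth_0)
  then have "fps_nth d 0 = 1" by (simp add: E_nth_0)
  then have "fps_nth S 0 = 1"
    by (simp add: S_def fps_power_zeroth E_nth_0)
  then have inv: "S * fps_right_inverse S 1 = 1"
    by (intro fps_right_inverse) simp
  have "sect 0 f * E 1 ^ 9 * E 2 ^ 5 = 288 * fps_X ^ 3 * E 6 ^ 15 + 5 * (fps_right_inverse S 1 * v)"
    using 4[folded v_def] inv by algebra
  then show ?thesis ..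
qed

end

section \<open>Reduction modulo 5\<close>

text \<open>
  The derivative of \<open>f\<^sup>5\<close> is \<open>5 f' f\<^sup>4\<close>, so \<open>n\<close> times the \<open>n\<close>-th coefficient of \<open>f\<^sup>5\<close> is divisible by \<open>5\<close>.
\<close>
lemma five_dvd_fifth_power_nth:
  fixes f :: "int fps"
  assumes "\<not> 5 dvd n"
  shows "5 dvd fps_nth (f ^ 5) n"
proof -
  obtain m where n: "n = Suc m" using assms by (cases n) auto
  have "int n * fps_nth (f ^ 5) n = fps_nth (fps_deriv (f ^ 5)) m"
    by (simp add: n)
  also have "\<dots> = 5 * fps_nth (fps_deriv f * f ^ 4) m"
    unfolding fps_deriv_power by (simp add: mult.assoc)
  finally have "5 dvd int n * fps_nth (f ^ 5) n" by simp
  moreover have "coprime 5 (int n)"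
    using assms prime_imp_coprime[of "5::int" "int n"] by (simp add: int_dvd_int_iff[of 5, simplified])
  ultimately show ?thesis by (simp add: coprime_dvd_mult_right_iff)
qed

text \<open>
  Modulo \<open>5\<close> a fifth power is a series in \<open>q\<^sup>5\<close>, so multiplication by it does not mix the residue
  classes of exponents.
\<close>
lemma five_dvd_nth_mult_fifth_power:
  fixes f g :: "int fps"
  assumes "\<And>m. m mod 5 = n mod 5 \<Longrightarrow> 5 dvd fps_nth f m"
  shows "5 dvd fps_nth (f * g ^ 5) n"
  unfolding fps_mult_nth
proof (rule dvd_sum)
  fix i assume "i \<in> {0..n}"
  show "5 dvd fps_nth f i * fps_nth (g ^ 5) (n - i)"
  proof (cases "5 dvd n - i")
    case True
    then have "i mod 5 = n mod 5" using \<open>i \<in> {0..n}\<close>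
      using mod_eq_dvd_iff_nat[of i n 5] by auto
    then show ?thesis using assms by simp
  next
    case False
    then show ?thesis using five_dvd_fifth_power_nth by simp
  qed
qed

theorem theorem4p2:
  fixes n t :: nat
  assumes "t \<in> {9, 18}"
  shows "[c (45 * n + t) = 0] (mod 5)"
proof -
  define C where "C = Abs_fps c"
  define G where "G = sect 0 (sect 0 C)"
  have "C * (E 1 * E 2) = fps_X * E 6 ^ 3"
    using c_gf_eq by (simp add: C_def euler_prod_eq_qprod)
  from sect_0_sect_0_gf[OF sect_0_gf[OF this]] obtain w
    where w: "G * E 1 ^ 9 * E 2 ^ 5 = 288 * fps_X ^ 3 * E 6 ^ 15 + 5 * w"
    unfolding G_def by blast
  \<comment> \<open>One more factor \<open>E 1\<close> completes the denominator to the fifth power of \<open>u\<close>; it reappears in the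
      numerator and carries the pentagonal exponents.\<close>
  define u where "u = E 1 ^ 2 * E 2"
  define v where "v = fps_right_inverse u 1"
  have "u * v = 1"
    unfolding v_def by (rule fps_right_inverse) (simp add: u_def fps_power_zeroth E_nth_0)
  then have uv: "u ^ 5 * v ^ 5 = 1" by (simp flip: power_mult_distrib)
  have "G * u ^ 5 = E 1 * (G * E 1 ^ 9 * E 2 ^ 5)" unfolding u_def by algebra
  also have "\<dots> = 288 * fps_X ^ 3 * E 1 * (E 6 ^ 3) ^ 5 + 5 * (w * E 1)"
    unfolding w by algebra
  finally have "G = 288 * (E 1 * fps_X ^ 3) * (E 6 ^ 3 * v) ^ 5 + 5 * (w * E 1 * v ^ 5)"
    using uv by algebra
  moreover have "5 dvd fps_nth (288 * (E 1 * fps_X ^ 3) * (E 6 ^ 3 * v) ^ 5 + 5 * (w * E 1 * v ^ 5)) m"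
    if "m mod 5 \<in> {1, 2}" for m
  proof -
    have "5 dvd fps_nth (288 * (E 1 * fps_X ^ 3) * (E 6 ^ 3 * v) ^ 5) m"
    proof (rule five_dvd_nth_mult_fifth_power)
      fix i assume "i mod 5 = m mod 5"
      have "fps_nth (E 1 * fps_X ^ 3) i = 0"
      proof (cases "i < 3")
        case False
        then have "(i - 3) mod 5 \<in> {3, 4}" using that \<open>i mod 5 = m mod 5\<close> by auto presburger+
        then show ?thesis using False euler_nth_eq_0 by (simp add: fps_X_power_mult_right_nth)
      qed (simp add: fps_X_power_mult_right_nth)
      then show "5 dvd fps_nth (288 * (E 1 * fps_X ^ 3)) i"
        by (simp add: numeral_fps_const)
    qed
    then show ?thesis by (simp add: numeral_fps_const)
  qed
  ultimately have G: "5 dvd fps_nth G m" if "m mod 5 \<in> {1, 2}" for m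
    using that by simp
  have "c (45 * n + t) = fps_nth G (5 * n + t div 9)"
    using assms by (auto simp: G_def C_def sect_def)
  moreover have "(5 * n + t div 9) mod 5 \<in> {1, 2}" using assms by auto
  ultimately show ?thesis using G by (simp add: cong_0_iff)
qed

end
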